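(* Let $(M,\varphi,\eta,\xi,g)$ be a 3-dimensional quasi-para-Sasakian manifold satisfying $R(X,Y)\cdot \mathrm{Ric}=0$ for all tangent vectors $X,Y\in T_pM$, $p\in M$. Then $M$ is a manifold of constant negative curvature $-1$.
   Context: An almost paracontact metric manifold $(M,\varphi,\eta,\xi,g)$ is a smooth manifold $M$ of dimension $2n+1$ ($n\ge 1$; here $n=1$) with a $(1,1)$-tensor field $\varphi$, a vector field $\xi$, a 1-form $\eta$ and a pseudo-Riemannian metric $g$ such that $\varphi\xi=0$, $\eta\circ\varphi=0$, $\eta(\xi)=1$, $\varphi^2=\mathrm{id}-\eta\otimes\xi$, $\varphi$ induces an almost paracomplex structure on each fibre of $\mathbb D=\ker\eta$, and $g(\varphi X,\varphi Y)=-g(X,Y)+\eta(X)\eta(Y)$ for all $X,Y$ (hence $\eta(X)=g(X,\xi)$ and $g$ has signature $(n+1,n)$). It is quasi-para-Sasakian if $(\nabla_X\varphi)Y=g(X,Y)\xi-\eta(Y)X$ for all vector fields $X,Y$, where $\nabla$ is the Levi-Civita connection of $g$. The curvature tensor is $R(X,Y)Z=\nabla_X\nabla_YZ-\nabla_Y\nabla_XZ-\nabla_{[X,Y]}Z$, and $\mathrm{Ric}(Y,Z)=\mathrm{tr}(X\mapsto R(X,Y)Z)$. $R(X,Y)$ acts as a derivation of the tensor algebra at each point, so $R(X,Y)\cdot\mathrm{Ric}=0$ means $\mathrm{Ric}(R(X,Y)U,V)+\mathrm{Ric}(U,R(X,Y)V)=0$ for all $U,V$. Constant curvature $c$ means $R(X,Y)Z=c\,(g(Y,Z)X-g(X,Z)Y)$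 for all $X,Y,Z$. *)

theory Defs
  imports "HOL-Analysis.Analysis" "HOL-Library.Function_Algebras"
begin

text \<open>
  Real-valued functions, tangent vectors (functionals on functions) and vector fields are all
  functions with values in a real vector space. With the pointwise operations, the notions of
  linear algebra from the library (subspace, independent, span, dim, representation) apply to them.
\<close>

instantiation "fun" :: (type, real_vector) real_vector
begin

definition scaleR_fun :: "real \<Rightarrow> ('a \<Rightarrow> 'b) \<Rightarrow> 'a \<Rightarrow> 'b" where
  "scaleR_fun r f = (\<lambda>x. r *\<^sub>R f x)"

instance
  by standard
    (auto simp: scaleR_fun_def fun_eq_iff scaleR_add_right scaleR_add_left)

end

definition linear_on :: "'a::real_vector set \<Rightarrow> ('a \<Rightarrow> 'b::real_vector) \<Rightarrow> bool" where
  "linear_on S F \<longleftrightarrow>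
     (\<forall>u\<in>S. \<forall>v\<in>S. F (u + v) = F u + F v) \<and> (\<forall>r. \<forall>u\<in>S. F (r *\<^sub>R u) = r *\<^sub>R F u)"

text \<open>Trace of an endomorphism \<open>F\<close> of a finite-dimensional subspace \<open>S\<close>, computed in any basis.\<close>

definition trace_on :: "'a::real_vector set \<Rightarrow> ('a \<Rightarrow> 'a) \<Rightarrow> real" where
  "trace_on S F =
     (let B = SOME B. independent B \<and> span B = S in \<Sum>b\<in>B. representation B (F b) b)"


section \<open>Smooth manifolds\<close>

text \<open>Continuous differentiability of order \<open>k\<close>; intended for open sets \<open>S\<close>.\<close>

fun Ck_on :: "nat \<Rightarrow> 'a::euclidean_space set \<Rightarrow> ('a \<Rightarrow> 'b::real_normed_vector) \<Rightarrow> bool" where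
  "Ck_on 0 S f \<longleftrightarrow> continuous_on S f"
| "Ck_on (Suc k) S f \<longleftrightarrow>
     f differentiable_on S \<and> (\<forall>v. Ck_on k S (\<lambda>x. frechet_derivative f (at x) v))"

definition smooth_on :: "'a::euclidean_space set \<Rightarrow> ('a \<Rightarrow> 'b::real_normed_vector) \<Rightarrow> bool" where
  "smooth_on S f \<longleftrightarrow> (\<forall>k. Ck_on k S f)"

text \<open>A chart is a pair of its domain and its coordinate map; the values of the coordinate map
  outside the domain are irrelevant.\<close>

type_synonym ('m, 'e) chart = "'m set \<times> ('m \<Rightarrow> 'e)"

definition is_chart :: "('m::topological_space, 'e::euclidean_space) chart \<Rightarrow> bool" where
  "is_chart c \<longleftrightarrow> (case c of (U, \<kappa>) \<Rightarrow>
     open U \<and> open (\<kappa> ` U) \<and> homeomorphism U (\<kappa> ` U) \<kappa> (inv_into U \<kappa>))"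

text \<open>The manifold is the whole type \<open>'m\<close> (Hausdorff and second countable), its smooth structure
  is the one generated by the atlas \<open>A\<close> (not required to be maximal), and its dimension
  is \<open>DIM('e)\<close>.\<close>

definition smooth_manifold ::
  "('m::{t2_space, second_countable_topology}, 'e::euclidean_space) chart set \<Rightarrow> bool" where
  "smooth_manifold A \<longleftrightarrow>
     (\<forall>c\<in>A. is_chart c) \<and>
     (\<Union>(U, \<kappa>)\<in>A. U) = UNIV \<and>
     (\<forall>(U, \<kappa>)\<in>A. \<forall>(U', \<kappa>')\<in>A. smooth_on (\<kappa> ` (U \<inter> U')) (\<kappa>' \<circ> inv_into U \<kappa>))"

definition smooth_functions :: "('m, 'e::euclidean_space) chart set \<Rightarrow> ('m \<Rightarrow> real) set" where
  "smooth_functions A = {f. \<forall>(U, \<kappa>)\<in>A. smooth_on (\<kappa> ` U) (f \<circ> inv_into U \<kappa>)}"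

text \<open>Tangent vectors at \<open>p\<close> are the derivations at \<open>p\<close> of the algebra of smooth functions.
  They are extended by \<open>0\<close> to functions that are not smooth, so that a derivation is represented
  by exactly one functional.\<close>

type_synonym 'm tangent_vector = "('m \<Rightarrow> real) \<Rightarrow> real"

type_synonym 'm vector_field = "'m \<Rightarrow> 'm tangent_vector"

definition tangent_space ::
  "('m, 'e::euclidean_space) chart set \<Rightarrow> 'm \<Rightarrow> 'm tangent_vector set" where
  "tangent_space A p = {v.
     linear_on (smooth_functions A) v \<and>
     (\<forall>f\<in>smooth_functions A. \<forall>h\<in>smooth_functions A. v (f * h) = f p * v h + h p * v f) \<and>
     (\<forall>f. f \<notin> smooth_functions A \<longrightarrow> v f = 0)}"

definition vector_fields :: "('m, 'e::euclidean_space) chart set \<Rightarrow> 'm vector_field set" where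
  "vector_fields A = {X.
     (\<forall>p. X p \<in> tangent_space A p) \<and>
     (\<forall>f\<in>smooth_functions A. (\<lambda>p. X p f) \<in> smooth_functions A)}"

definition lie_bracket :: "'m vector_field \<Rightarrow> 'm vector_field \<Rightarrow> 'm vector_field" where
  "lie_bracket X Y = (\<lambda>p f. X p (\<lambda>q. Y q f) - Y p (\<lambda>q. X q f))"


section \<open>Tensor fields\<close>

definition one_form ::
  "('m, 'e::euclidean_space) chart set \<Rightarrow> ('m \<Rightarrow> 'm tangent_vector \<Rightarrow> real) \<Rightarrow> bool" where
  "one_form A \<eta> \<longleftrightarrow>
     (\<forall>p. linear_on (tangent_space A p) (\<eta> p)) \<and>
     (\<forall>X\<in>vector_fields A. (\<lambda>p. \<eta> p (X p)) \<in> smooth_functions A)"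

definition tensor_field_1_1 ::
  "('m, 'e::euclidean_space) chart set \<Rightarrow> ('m \<Rightarrow> 'm tangent_vector \<Rightarrow> 'm tangent_vector) \<Rightarrow> bool"
  where
  "tensor_field_1_1 A \<phi> \<longleftrightarrow>
     (\<forall>p. linear_on (tangent_space A p) (\<phi> p) \<and>
          (\<forall>u\<in>tangent_space A p. \<phi> p u \<in> tangent_space A p)) \<and>
     (\<forall>X\<in>vector_fields A. (\<lambda>p. \<phi> p (X p)) \<in> vector_fields A)"

definition pseudo_riemannian_metric ::
  "('m, 'e::euclidean_space) chart set \<Rightarrow>
   ('m \<Rightarrow> 'm tangent_vector \<Rightarrow> 'm tangent_vector \<Rightarrow> real) \<Rightarrow> bool" where
  "pseudo_riemannian_metric A g \<longleftrightarrow>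
     (\<forall>p. \<forall>u\<in>tangent_space A p.
        linear_on (tangent_space A p) (g p u) \<and>
        (\<forall>v\<in>tangent_space A p. g p u v = g p v u) \<and>
        ((\<forall>v\<in>tangent_space A p. g p u v = 0) \<longrightarrow> u = 0)) \<and>
     (\<forall>X\<in>vector_fields A. \<forall>Y\<in>vector_fields A. (\<lambda>p. g p (X p) (Y p)) \<in> smooth_functions A)"


section \<open>Connections and curvature\<close>

definition affine_connection ::
  "('m, 'e::euclidean_space) chart set \<Rightarrow>
   ('m vector_field \<Rightarrow> 'm vector_field \<Rightarrow> 'm vector_field) \<Rightarrow> bool" where
  "affine_connection A D \<longleftrightarrow>
     (\<forall>X\<in>vector_fields A. \<forall>Y\<in>vector_fields A. D X Y \<in> vector_fields A) \<and>
     (\<forall>X\<in>vector_fields A. \<forall>Y\<in>vector_fields A. \<forall>Z\<in>vector_fields A.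
        D (X + Y) Z = D X Z + D Y Z \<and> D X (Y + Z) = D X Y + D X Z) \<and>
     (\<forall>f\<in>smooth_functions A. \<forall>X\<in>vector_fields A. \<forall>Y\<in>vector_fields A.
        D (\<lambda>p. f p *\<^sub>R X p) Y = (\<lambda>p. f p *\<^sub>R D X Y p) \<and>
        D X (\<lambda>p. f p *\<^sub>R Y p) = (\<lambda>p. f p *\<^sub>R D X Y p + X p f *\<^sub>R Y p))"

text \<open>The Levi-Civita connection: torsion-free and compatible with the metric, the latter
  reading \<open>X(g(Y,Z)) = g(D\<^sub>XY,Z) + g(Y,D\<^sub>XZ)\<close>.\<close>

definition levi_civita ::
  "('m, 'e::euclidean_space) chart set \<Rightarrow>
   ('m \<Rightarrow> 'm tangent_vector \<Rightarrow> 'm tangent_vector \<Rightarrow> real) \<Rightarrow>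
   ('m vector_field \<Rightarrow> 'm vector_field \<Rightarrow> 'm vector_field) \<Rightarrow> bool" where
  "levi_civita A g D \<longleftrightarrow>
     affine_connection A D \<and>
     (\<forall>X\<in>vector_fields A. \<forall>Y\<in>vector_fields A. D X Y - D Y X = lie_bracket X Y) \<and>
     (\<forall>X\<in>vector_fields A. \<forall>Y\<in>vector_fields A. \<forall>Z\<in>vector_fields A. \<forall>p.
        X p (\<lambda>q. g q (Y q) (Z q)) = g p (D X Y p) (Z p) + g p (Y p) (D X Z p))"

definition curvature_operator ::
  "('m vector_field \<Rightarrow> 'm vector_field \<Rightarrow> 'm vector_field) \<Rightarrow>
   'm vector_field \<Rightarrow> 'm vector_field \<Rightarrow> 'm vector_field \<Rightarrow> 'm vector_field" where
  "curvature_operator D X Y Z = D X (D Y Z) - D Y (D X Z) - D (lie_bracket X Y) Z"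

text \<open>The curvature operator is tensorial, so its value at \<open>p\<close> depends only on the values of the
  vector fields at \<open>p\<close>. The curvature tensor on tangent vectors is therefore obtained from arbitrary
  extensions of these vectors to smooth vector fields, which always exist.\<close>

definition extension ::
  "('m, 'e::euclidean_space) chart set \<Rightarrow> 'm \<Rightarrow> 'm tangent_vector \<Rightarrow> 'm vector_field" where
  "extension A p u = (SOME X. X \<in> vector_fields A \<and> X p = u)"

definition curvature_tensor ::
  "('m, 'e::euclidean_space) chart set \<Rightarrow>
   ('m vector_field \<Rightarrow> 'm vector_field \<Rightarrow> 'm vector_field) \<Rightarrow>
   'm \<Rightarrow> 'm tangent_vector \<Rightarrow> 'm tangent_vector \<Rightarrow> 'm tangent_vector \<Rightarrow> 'm tangent_vector" where
  "curvature_tensor A D p u v w =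
     curvature_operator D (extension A p u) (extension A p v) (extension A p w) p"

definition ricci ::
  "('m, 'e::euclidean_space) chart set \<Rightarrow>
   ('m vector_field \<Rightarrow> 'm vector_field \<Rightarrow> 'm vector_field) \<Rightarrow>
   'm \<Rightarrow> 'm tangent_vector \<Rightarrow> 'm tangent_vector \<Rightarrow> real" where
  "ricci A D p v w = trace_on (tangent_space A p) (\<lambda>u. curvature_tensor A D p u v w)"

text \<open>\<open>R(x,y)\<close> acts on the tensor algebra of the tangent space as a derivation; on a bilinear form
  \<open>S\<close> this gives \<open>(R(x,y)\<cdot>S)(u,v) = -S(R(x,y)u,v) - S(u,R(x,y)v)\<close>.\<close>

definition ricci_semisymmetric ::
  "('m, 'e::euclidean_space) chart set \<Rightarrow>
   ('m vector_field \<Rightarrow> 'm vector_field \<Rightarrow> 'm vector_field) \<Rightarrow> bool" where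
  "ricci_semisymmetric A D \<longleftrightarrow>
     (\<forall>p. \<forall>x\<in>tangent_space A p. \<forall>y\<in>tangent_space A p.
        \<forall>u\<in>tangent_space A p. \<forall>v\<in>tangent_space A p.
          ricci A D p (curvature_tensor A D p x y u) v +
          ricci A D p u (curvature_tensor A D p x y v) = 0)"

definition constant_curvature ::
  "('m, 'e::euclidean_space) chart set \<Rightarrow>
   ('m \<Rightarrow> 'm tangent_vector \<Rightarrow> 'm tangent_vector \<Rightarrow> real) \<Rightarrow>
   ('m vector_field \<Rightarrow> 'm vector_field \<Rightarrow> 'm vector_field) \<Rightarrow> real \<Rightarrow> bool" where
  "constant_curvature A g D c \<longleftrightarrow>
     (\<forall>p. \<forall>x\<in>tangent_space A p. \<forall>y\<in>tangent_space A p. \<forall>z\<in>tangent_space A p.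
        curvature_tensor A D p x y z = c *\<^sub>R (g p y z *\<^sub>R x - g p x z *\<^sub>R y))"


section \<open>Almost paracontact metric and quasi-para-Sasakian manifolds\<close>

text \<open>An almost paracomplex structure on a vector space: an involution whose eigenspaces for
  \<open>1\<close> and \<open>-1\<close> have the same dimension.\<close>

definition almost_paracomplex_structure :: "'a::real_vector set \<Rightarrow> ('a \<Rightarrow> 'a) \<Rightarrow> bool" where
  "almost_paracomplex_structure S J \<longleftrightarrow>
     linear_on S J \<and> (\<forall>u\<in>S. J u \<in> S \<and> J (J u) = u) \<and>
     dim {u\<in>S. J u = u} = dim {u\<in>S. J u = - u}"

definition almost_paracontact_metric_manifold ::
  "('m::{t2_space, second_countable_topology}, 'e::euclidean_space) chart set \<Rightarrow>
   ('m \<Rightarrow> 'm tangent_vector \<Rightarrow> 'm tangent_vector) \<Rightarrow> ('m \<Rightarrow> 'm tangent_vector \<Rightarrow> real) \<Rightarrow>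
   'm vector_field \<Rightarrow> ('m \<Rightarrow> 'm tangent_vector \<Rightarrow> 'm tangent_vector \<Rightarrow> real) \<Rightarrow> bool" where
  "almost_paracontact_metric_manifold A \<phi> \<eta> \<xi> g \<longleftrightarrow>
     smooth_manifold A \<and> (\<exists>n\<ge>1. DIM('e) = 2 * n + 1) \<and>
     tensor_field_1_1 A \<phi> \<and> one_form A \<eta> \<and> \<xi> \<in> vector_fields A \<and>
     pseudo_riemannian_metric A g \<and>
     (\<forall>p. \<phi> p (\<xi> p) = 0 \<and> \<eta> p (\<xi> p) = 1 \<and>
        (\<forall>u\<in>tangent_space A p. \<eta> p (\<phi> p u) = 0 \<and> \<phi> p (\<phi> p u) = u - \<eta> p u *\<^sub>R \<xi> p) \<and>
        almost_paracomplex_structure {u\<in>tangent_space A p. \<eta> p u = 0} (\<phi> p) \<and>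
        (\<forall>u\<in>tangent_space A p. \<forall>v\<in>tangent_space A p.
           g p (\<phi> p u) (\<phi> p v) = - g p u v + \<eta> p u * \<eta> p v))"

text \<open>\<open>D\<close> is the Levi-Civita connection of \<open>g\<close>; the left-hand side of the last equation
  is \<open>(D\<^sub>X\<phi>)Y = D\<^sub>X(\<phi>Y) - \<phi>(D\<^sub>XY)\<close>.\<close>

definition quasi_para_sasakian_manifold ::
  "('m::{t2_space, second_countable_topology}, 'e::euclidean_space) chart set \<Rightarrow>
   ('m \<Rightarrow> 'm tangent_vector \<Rightarrow> 'm tangent_vector) \<Rightarrow> ('m \<Rightarrow> 'm tangent_vector \<Rightarrow> real) \<Rightarrow>
   'm vector_field \<Rightarrow> ('m \<Rightarrow> 'm tangent_vector \<Rightarrow> 'm tangent_vector \<Rightarrow> real) \<Rightarrow>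
   ('m vector_field \<Rightarrow> 'm vector_field \<Rightarrow> 'm vector_field) \<Rightarrow> bool" where
  "quasi_para_sasakian_manifold A \<phi> \<eta> \<xi> g D \<longleftrightarrow>
     almost_paracontact_metric_manifold A \<phi> \<eta> \<xi> g \<and> levi_civita A g D \<and>
     (\<forall>X\<in>vector_fields A. \<forall>Y\<in>vector_fields A. \<forall>p.
        D X (\<lambda>q. \<phi> q (Y q)) p - \<phi> p (D X Y p) = g p (X p) (Y p) *\<^sub>R \<xi> p - \<eta> p (Y p) *\<^sub>R X p)"

end

theory Submission
  imports Defs
begin

text \<open>
  The structure equation with \<open>Y = \<xi>\<close> gives \<open>\<nabla>\<^sub>X\<xi> = \<phi>X\<close>, hence \<open>R(X,Y)\<xi> = \<eta>(X)Y - \<eta>(Y)X\<close> and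
  \<open>Ric(Y,\<xi>) = -2\<eta>(Y)\<close> in dimension 3. Inserting \<open>Y = V = \<xi>\<close> into \<open>R(X,Y)\<cdot>Ric = 0\<close> yields
  \<open>Ric = -2g\<close>. The difference \<open>Q\<close> of \<open>R\<close> and the curvature tensor of constant curvature \<open>-1\<close> is
  therefore an algebraic curvature tensor with \<open>Q(X,Y)\<xi> = 0\<close> and zero Ricci trace. The
  Bianchi identity and skew-symmetry make \<open>Q\<close> vanish as soon as one argument is \<open>\<xi>\<close>, so it is
  determined by the plane \<open>ker \<eta>\<close>, which is spanned by null eigenvectors of \<open>\<phi>\<close>; the only
  remaining component is a Ricci trace.

  Tangent vectors being derivations of the globally smooth functions, the passage from vector
  fields to tangent vectors rests on bump functions and Hadamard's lemma: they show that the
  tangent spaces have dimension 3, that every tangent vector extends to a vector field, and that a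
  vector field vanishing at \<open>p\<close> is, up to a factor nonzero at \<open>p\<close>, a combination of vector fields
  with coefficients vanishing at \<open>p\<close>, so that \<open>R\<close> is a tensor.
\<close>

section \<open>Calculus of smooth functions on Euclidean spaces\<close>

text \<open>The choice \<open>Y = V = \<xi>\<close> works because
  \<open>R(X,\<xi>)\<xi> = \<eta>(X)\<xi> - X\<close>: one of the two Ricci terms then has
  \<open>\<xi>\<close> as an argument and is known, the other contains \<open>Ric(U,X)\<close> with
  coefficient -1, so the condition can be solved for it. The value \<open>-2g\<close> is also the
  Ricci tensor of constant curvature -1 in dimension 3, which is why \<open>Q\<close> is trace-free.

  The obstacle on the manifold side is that derivations act on globally defined smooth functions,
  whereas coordinates exist only in a chart. Every local identity is therefore multiplied by a bump
  \<open>\<psi>\<close> until both sides extend by zero. The bump is positive on its ball but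
  nowhere equal to 1, so the identities carry powers of \<open>\<psi>\<close>, which are divided out
  at the point. Since the curvature tensor is defined through chosen extensions, its algebraic
  properties are proved for vector fields and then transferred to tangent vectors.\<close>

lemma Ck_on_cong:
  assumes "open S" "\<And>x. x \<in> S \<Longrightarrow> f x = g x" "Ck_on k S f"
  shows "Ck_on k S g"
  using assms(2,3)
proof (induction k arbitrary: f g)
  case 0
  then show ?case by (simp cong: continuous_on_cong)
next
  case (Suc k)
  have der: "(g has_derivative frechet_derivative f (at x)) (at x)" if "x \<in> S" for x
  proof (rule has_derivative_transform_within_open)
    show "(f has_derivative frechet_derivative f (at x)) (at x)"
      using Suc.prems(2) that assms(1)
      by (simp add: differentiable_on_eq_differentiable_at frechet_derivative_works[symmetric])
  qed (use that assms(1) Suc.prems(1) in auto)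
  have "g differentiable_on S"
    using der assms(1) by (auto simp: differentiable_on_eq_differentiable_at differentiable_def)
  moreover have "Ck_on k S (\<lambda>x. frechet_derivative g (at x) v)" for v
  proof (rule Suc.IH)
    show "Ck_on k S (\<lambda>x. frechet_derivative f (at x) v)"
      using Suc.prems(2) by simp
  qed (use der in \<open>metis frechet_derivative_at\<close>)
  ultimately show ?case by simp
qed

text \<open>\<open>frechet_derivative\<close> is a choice operator; uniqueness of the derivative at
  interior points lets any explicit \<open>f'\<close> stand for it. The closure properties below are
  inductions that supply such an \<open>f'\<close>.\<close>

lemma Ck_on_SucI:
  assumes "open S" "\<And>x. x \<in> S \<Longrightarrow> (f has_derivative f' x) (at x)" "\<And>v. Ck_on k S (\<lambda>x. f' x v)"
  shows "Ck_on (Suc k) S f"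
proof -
  have "f differentiable_on S"
    using assms by (auto simp: differentiable_on_eq_differentiable_at differentiable_def)
  moreover have "Ck_on k S (\<lambda>x. frechet_derivative f (at x) v)" for v
    by (rule Ck_on_cong[OF assms(1) _ assms(3)[of v]]) (metis assms(2) frechet_derivative_at)
  ultimately show ?thesis by simp
qed

lemma Ck_on_has_derivative:
  assumes "open S" "Ck_on (Suc k) S f" "x \<in> S"
  shows "(f has_derivative frechet_derivative f (at x)) (at x)"
  using assms by (simp add: differentiable_on_eq_differentiable_at frechet_derivative_works[symmetric])

lemma Ck_on_SucD: "Ck_on (Suc k) S f \<Longrightarrow> Ck_on k S f"
  by (induction k arbitrary: f) (auto simp: differentiable_imp_continuous_on)

lemma Ck_on_subset: "Ck_on k S f \<Longrightarrow> T \<subseteq> S \<Longrightarrow> Ck_on k T f"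
  by (induction k arbitrary: f) (auto intro: continuous_on_subset differentiable_on_subset)

text \<open>Continuity and differentiability are local, and the derivative at \<open>x\<close> sees
  only a neighbourhood of \<open>x\<close>. This glues a function that has different descriptions
  near different points, as in \<open>smooth_cutoff\<close>.\<close>

lemma Ck_on_local:
  assumes "\<And>x. x \<in> S \<Longrightarrow> \<exists>T. open T \<and> x \<in> T \<and> Ck_on k T f"
  shows "Ck_on k S f"
  using assms
proof (induction k arbitrary: f)
  case 0
  show ?case
    unfolding Ck_on.simps continuous_on_eq_continuous_within
  proof
    fix x assume "x \<in> S"
    from 0[OF this] obtain T where "open T" "x \<in> T" "continuous_on T f" by auto
    then show "continuous (at x within S) f"
      by (metis continuous_on_eq_continuous_at continuous_at_imp_continuous_within)
  qed
next
  case (Suc k)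
  have "f differentiable_on S"
    unfolding differentiable_on_def
  proof
    fix x assume "x \<in> S"
    from Suc.prems[OF this] obtain T where "open T" "x \<in> T" "f differentiable_on T" by auto
    then show "f differentiable (at x within S)"
      by (metis differentiable_on_eq_differentiable_at differentiable_at_withinI)
  qed
  moreover have "Ck_on k S (\<lambda>x. frechet_derivative f (at x) v)" for v
  proof (rule Suc.IH)
    fix x assume "x \<in> S"
    from Suc.prems[OF this]
    show "\<exists>T. open T \<and> x \<in> T \<and> Ck_on k T (\<lambda>x. frechet_derivative f (at x) v)" by auto
  qed
  ultimately show ?case by simp
qed

lemma Ck_on_const: "open S \<Longrightarrow> Ck_on k S (\<lambda>x. c)"
  by (induction k arbitrary: c) (simp, rule Ck_on_SucI[where f' = "\<lambda>_ _. 0"], auto)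

lemma Ck_on_bounded_linear:
  assumes "open S" "bounded_linear f"
  shows "Ck_on k S f"
proof (cases k)
  case 0
  then show ?thesis by (simp add: assms linear_continuous_on)
next
  case (Suc l)
  have "(f has_derivative f) (at x)" for x
    using assms(2) by (rule bounded_linear_imp_has_derivative)
  then show ?thesis
    unfolding Suc by (rule Ck_on_SucI[OF assms(1) _ Ck_on_const[OF assms(1)]])
qed

lemma Ck_on_linear_image:
  assumes "open S" "bounded_linear L" "Ck_on k S f"
  shows "Ck_on k S (\<lambda>x. L (f x))"
  using assms(3)
proof (induction k arbitrary: f)
  case 0
  then show ?case by (simp add: assms(2) bounded_linear.continuous_on)
next
  case (Suc k)
  show ?case
  proof (rule Ck_on_SucI[OF assms(1)])
    show "((\<lambda>x. L (f x)) has_derivative (\<lambda>v. L (frechet_derivative f (at x) v))) (at x)"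
      if "x \<in> S" for x
      using Ck_on_has_derivative[OF assms(1) Suc.prems that]
      by (rule bounded_linear.has_derivative[OF assms(2)])
  qed (rule Suc.IH, use Suc.prems in simp)
qed

lemma Ck_on_add:
  assumes "open S" "Ck_on k S f" "Ck_on k S g"
  shows "Ck_on k S (\<lambda>x. f x + g x)"
  using assms(2,3)
proof (induction k arbitrary: f g)
  case 0
  then show ?case by (simp add: continuous_on_add)
next
  case (Suc k)
  note D = Ck_on_has_derivative[OF assms(1)]
  show ?case
  proof (rule Ck_on_SucI[OF assms(1)])
    show "((\<lambda>x. f x + g x) has_derivative
        (\<lambda>v. frechet_derivative f (at x) v + frechet_derivative g (at x) v)) (at x)"
      if "x \<in> S" for x
      using D[OF Suc.prems(1) that] D[OF Suc.prems(2) that] by (rule has_derivative_add)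
  qed (rule Suc.IH; use Suc.prems in simp)
qed

lemma Ck_on_sum:
  assumes "open S" "\<And>i. i \<in> I \<Longrightarrow> Ck_on k S (f i)"
  shows "Ck_on k S (\<lambda>x. \<Sum>i\<in>I. f i x)"
  using assms(2)
  by (induction I rule: infinite_finite_induct) (simp_all add: Ck_on_const Ck_on_add assms(1))

lemma Ck_on_mult:
  fixes f g :: "'a::euclidean_space \<Rightarrow> real"
  assumes "open S" "Ck_on k S f" "Ck_on k S g"
  shows "Ck_on k S (\<lambda>x. f x * g x)"
  using assms(2,3)
proof (induction k arbitrary: f g)
  case 0
  then show ?case by (simp add: continuous_on_mult)
next
  case (Suc k)
  note D = Ck_on_has_derivative[OF assms(1)]
  show ?case
  proof (rule Ck_on_SucI[OF assms(1)])
    show "((\<lambda>x. f x * g x) has_derivative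
        (\<lambda>v. f x * frechet_derivative g (at x) v + frechet_derivative f (at x) v * g x)) (at x)"
      if "x \<in> S" for x
      using D[OF Suc.prems(1) that] D[OF Suc.prems(2) that] by (rule has_derivative_mult)
    show "Ck_on k S (\<lambda>x. f x * frechet_derivative g (at x) v + frechet_derivative f (at x) v * g x)"
      for v
      by (intro Ck_on_add[OF assms(1)] Suc.IH)
         (use Suc.prems Ck_on_SucD[OF Suc.prems(1)] Ck_on_SucD[OF Suc.prems(2)] in simp_all)
  qed
qed

text \<open>The definition of \<open>Ck_on\<close> controls derivatives in a fixed direction only,
  while the chain rule produces the derivative of \<open>f\<close> in a direction that varies with
  \<open>x\<close>. Expanding this direction in \<open>Basis\<close> leaves products of directional
  derivatives of \<open>g\<close> with functions \<open>frechet_derivative f (at (g x)) i\<close>,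
  to which the induction hypothesis applies.\<close>

lemma Ck_on_compose:
  fixes f :: "'b::euclidean_space \<Rightarrow> real" and g :: "'a::euclidean_space \<Rightarrow> 'b"
  assumes "open S" "open T" "Ck_on k T f" "Ck_on k S g" "g ` S \<subseteq> T"
  shows "Ck_on k S (\<lambda>x. f (g x))"
  using assms(3,4)
proof (induction k arbitrary: f)
  case 0
  then show ?case using assms(5) by (auto intro: continuous_on_compose2)
next
  case (Suc k)
  show ?case
  proof (rule Ck_on_SucI[OF assms(1)])
    fix x assume x: "x \<in> S"
    let ?F = "frechet_derivative f (at (g x))" and ?G = "frechet_derivative g (at x)"
    have F: "(f has_derivative ?F) (at (g x))"
      using Ck_on_has_derivative[OF assms(2) Suc.prems(1)] x assms(5) by blast
    have F_sum: "?F w = (\<Sum>i\<in>Basis. (w \<bullet> i) * ?F i)" for w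
    proof -
      have "linear ?F" using F has_derivative_linear by blast
      then have "?F (\<Sum>i\<in>Basis. (w \<bullet> i) *\<^sub>R i) = (\<Sum>i\<in>Basis. (w \<bullet> i) * ?F i)"
        by (simp add: linear_sum linear_scale)
      then show ?thesis by (simp add: euclidean_representation)
    qed
    have "((\<lambda>x. f (g x)) has_derivative (\<lambda>v. ?F (?G v))) (at x)"
      using has_derivative_compose[OF Ck_on_has_derivative[OF assms(1) Suc.prems(2) x] F] .
    then show "((\<lambda>x. f (g x)) has_derivative
        (\<lambda>v. \<Sum>i\<in>Basis. (?G v \<bullet> i) * ?F i)) (at x)"
      by (simp only: F_sum[of "?G _"])
  next
    fix v
    have "Ck_on k S (\<lambda>x. frechet_derivative g (at x) v \<bullet> i)" for i
      by (rule Ck_on_linear_image[OF assms(1) bounded_linear_inner_left]) (use Suc.prems(2) in simp)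
    moreover have "Ck_on k S (\<lambda>x. frechet_derivative f (at (g x)) i)" for i
      by (rule Suc.IH) (use Suc.prems(1) Ck_on_SucD[OF Suc.prems(2)] in simp_all)
    ultimately show "Ck_on k S
        (\<lambda>x. \<Sum>i\<in>Basis. (frechet_derivative g (at x) v \<bullet> i) * frechet_derivative f (at (g x)) i)"
      by (intro Ck_on_sum Ck_on_mult assms(1))
  qed
qed

section \<open>Smooth functions: derivatives of every order\<close>

lemma smooth_on_cong: "open S \<Longrightarrow> (\<And>x. x \<in> S \<Longrightarrow> f x = g x) \<Longrightarrow> smooth_on S f \<Longrightarrow> smooth_on S g"
  unfolding smooth_on_def by (metis Ck_on_cong)

lemma smooth_on_subset: "smooth_on S f \<Longrightarrow> T \<subseteq> S \<Longrightarrow> smooth_on T f"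
  unfolding smooth_on_def by (metis Ck_on_subset)

lemma smooth_on_local:
  assumes "\<And>x. x \<in> S \<Longrightarrow> \<exists>T. open T \<and> x \<in> T \<and> smooth_on T f"
  shows "smooth_on S f"
  unfolding smooth_on_def
proof
  fix k show "Ck_on k S f"
    using assms unfolding smooth_on_def by (intro Ck_on_local) blast
qed

lemma smooth_on_has_derivative:
  assumes "open S" "smooth_on S f" "x \<in> S"
  shows "(f has_derivative frechet_derivative f (at x)) (at x)"
  using Ck_on_has_derivative[OF assms(1) _ assms(3)] assms(2) unfolding smooth_on_def by blast

lemma smooth_on_frechet_derivative: "smooth_on S f \<Longrightarrow> smooth_on S (\<lambda>x. frechet_derivative f (at x) v)"
  unfolding smooth_on_def by (metis Ck_on.simps(2))

lemma smooth_on_imp_continuous_on: "smooth_on S f \<Longrightarrow> continuous_on S f"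
  unfolding smooth_on_def by (metis Ck_on.simps(1))

lemma smooth_on_const: "open S \<Longrightarrow> smooth_on S (\<lambda>x. c)"
  by (simp add: smooth_on_def Ck_on_const)

lemma smooth_on_bounded_linear: "open S \<Longrightarrow> bounded_linear f \<Longrightarrow> smooth_on S f"
  by (simp add: smooth_on_def Ck_on_bounded_linear)

lemma smooth_on_add:
  "open S \<Longrightarrow> smooth_on S f \<Longrightarrow> smooth_on S g \<Longrightarrow> smooth_on S (\<lambda>x. f x + g x)"
  by (simp add: smooth_on_def Ck_on_add)

lemma smooth_on_sum:
  "open S \<Longrightarrow> (\<And>i. i \<in> I \<Longrightarrow> smooth_on S (f i)) \<Longrightarrow> smooth_on S (\<lambda>x. \<Sum>i\<in>I. f i x)"
  by (simp add: smooth_on_def Ck_on_sum)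

lemma smooth_on_mult:
  fixes f g :: "'a::euclidean_space \<Rightarrow> real"
  shows "open S \<Longrightarrow> smooth_on S f \<Longrightarrow> smooth_on S g \<Longrightarrow> smooth_on S (\<lambda>x. f x * g x)"
  by (simp add: smooth_on_def Ck_on_mult)

lemma smooth_on_compose:
  fixes f :: "'b::euclidean_space \<Rightarrow> real" and g :: "'a::euclidean_space \<Rightarrow> 'b"
  shows "open S \<Longrightarrow> open T \<Longrightarrow> smooth_on T f \<Longrightarrow> smooth_on S g \<Longrightarrow> g ` S \<subseteq> T \<Longrightarrow>
    smooth_on S (\<lambda>x. f (g x))"
  unfolding smooth_on_def using Ck_on_compose by blast

lemma smooth_on_coordinate: "open S \<Longrightarrow> smooth_on S (\<lambda>x. (x - c) \<bullet> i)"
  using smooth_on_add[OF _ smooth_on_bounded_linear[OF _ bounded_linear_inner_left]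
      smooth_on_const[where c = "- (c \<bullet> i)"]]
  by (simp add: inner_diff_left)

subsection \<open>Bump functions\<close>

text \<open>The powers \<open>t ^ n\<close> in the denominator are those created by differentiating
  \<open>exp (- 1 / t)\<close>; with them the linear span of the family is closed under
  differentiation.\<close>

definition flat :: "nat \<Rightarrow> real \<Rightarrow> real" where
  "flat n t = (if t > 0 then exp (- 1 / t) / t ^ n else 0)"

text \<open>This is the difference quotient of \<open>flat n\<close> at 0. On the right the
  substitution \<open>s = 1 / t\<close> turns it into \<open>s ^ Suc n / exp s\<close>; on the left
  it is 0.\<close>

lemma flat_over_tendsto: "((\<lambda>t. flat n t / t) \<longlongrightarrow> 0) (at 0)"
proof -
  have "((\<lambda>t. inverse t ^ Suc n / exp (inverse t)) \<longlongrightarrow> (0::real)) (at_right 0)"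
    by (rule filterlim_compose[OF tendsto_power_div_exp_0 filterlim_inverse_at_top_right])
  moreover have "\<forall>\<^sub>F t in at_right 0. inverse t ^ Suc n / exp (inverse t) = flat n t / t"
    by (auto simp: flat_def exp_minus field_simps eventually_at_filter)
  ultimately have "((\<lambda>t. flat n t / t) \<longlongrightarrow> 0) (at_right 0)"
    by (rule Lim_transform_eventually)
  moreover have "((\<lambda>t. flat n t / t) \<longlongrightarrow> 0) (at_left 0)"
    by (rule Lim_transform_eventually[OF tendsto_const])
       (auto simp: flat_def eventually_at_filter)
  ultimately show ?thesis by (simp add: filterlim_split_at)
qed

text \<open>For \<open>t > 0\<close> the exponential contributes a factor
  \<open>1 / t\<^sup>2\<close> and the power a factor \<open>- n / t\<close>, hence the shifts of
  the index by 2 and by 1. At 0 all terms on the right are 0 by the default value of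
  \<open>flat\<close>, and the previous limit applies.\<close>

lemma flat_has_derivative:
  "(flat n has_derivative (\<lambda>v. v * (flat (n + 2) t - n * flat (n + 1) t))) (at t)"
proof -
  consider "t > 0" | "t < 0" | "t = 0" by linarith
  then have "(flat n has_real_derivative flat (n + 2) t - n * flat (n + 1) t) (at t)"
  proof cases
    case 1
    have "((\<lambda>t. exp (- 1 / t) / t ^ n) has_real_derivative
        ((exp (- 1 / t) * (1 / t\<^sup>2)) * t ^ n - exp (- 1 / t) * (n * t ^ (n - 1))) / (t ^ n * t ^ n)) (at t)"
      using 1 by (auto intro!: derivative_eq_intros simp: power2_eq_square)
    also have "((exp (- 1 / t) * (1 / t\<^sup>2)) * t ^ n - exp (- 1 / t) * (n * t ^ (n - 1))) / (t ^ n * t ^ n)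
        = flat (n + 2) t - n * flat (n + 1) t"
      using 1 by (cases n) (auto simp: flat_def field_simps power2_eq_square)
    finally show ?thesis
      by (rule has_field_derivative_transform_within_open[of _ _ _ "{0<..}"])
         (use 1 in \<open>auto simp: flat_def\<close>)
  next
    case 2
    have "((\<lambda>t. 0) has_real_derivative flat (n + 2) t - n * flat (n + 1) t) (at t)"
      using 2 by (simp add: flat_def)
    then show ?thesis
      by (rule has_field_derivative_transform_within_open[of _ _ _ "{..<0}"])
         (use 2 in \<open>auto simp: flat_def\<close>)
  next
    case 3
    then show ?thesis
      using flat_over_tendsto[of n] by (simp add: has_field_derivative_iff flat_def)
  qed
  then show ?thesis by (simp add: has_field_derivative_def mult_commute_abs)
qed

lemma smooth_on_flat: "smooth_on UNIV (flat n)"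
proof -
  have "Ck_on k UNIV (flat n)" for k
  proof (induction k arbitrary: n)
    case 0
    have "isCont (flat n) t" for t
      by (rule has_derivative_continuous[OF flat_has_derivative])
    then show ?case by (simp add: continuous_at_imp_continuous_on)
  next
    case (Suc k)
    show ?case
    proof (rule Ck_on_SucI[OF open_UNIV flat_has_derivative])
      fix v
      have "Ck_on k UNIV (\<lambda>t. v * (flat (n + 2) t + - real n * flat (n + 1) t))"
        by (intro Ck_on_mult Ck_on_add Ck_on_const open_UNIV Suc.IH)
      then show "Ck_on k UNIV (\<lambda>t. v * (flat (n + 2) t - real n * flat (n + 1) t))" by simp
    qed
  qed
  then show ?thesis by (simp add: smooth_on_def)
qed

text \<open>The squared norm is a polynomial in the coordinates, so that smoothness holds at
  \<open>c\<close> too. For \<open>r \<ge> 0\<close> the argument of \<open>flat 0\<close> is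
  positive exactly on \<open>ball c r\<close>.\<close>

definition bump :: "'a::euclidean_space \<Rightarrow> real \<Rightarrow> 'a \<Rightarrow> real" where
  "bump c r x = flat 0 (r\<^sup>2 - (norm (x - c))\<^sup>2)"

lemma bump_pos: "x \<in> ball c r \<Longrightarrow> bump c r x > 0"
proof -
  assume "x \<in> ball c r"
  then have "norm (x - c) < r" by (simp add: dist_norm norm_minus_commute)
  then have "(norm (x - c))\<^sup>2 < r\<^sup>2" by (simp add: power_strict_mono)
  then show ?thesis by (simp add: bump_def flat_def)
qed

lemma bump_eq_0: "r \<ge> 0 \<Longrightarrow> x \<notin> ball c r \<Longrightarrow> bump c r x = 0"
proof -
  assume "r \<ge> 0" "x \<notin> ball c r"
  then have "r\<^sup>2 \<le> (norm (x - c))\<^sup>2" by (simp add: dist_norm norm_minus_commute power_mono)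
  then show ?thesis by (simp add: bump_def flat_def)
qed

lemma smooth_on_bump: "open S \<Longrightarrow> smooth_on S (bump c r)"
proof -
  assume S: "open S"
  have "smooth_on S (\<lambda>x. r\<^sup>2 + (- 1) * (\<Sum>i\<in>Basis. ((x - c) \<bullet> i) * ((x - c) \<bullet> i)))"
    by (intro smooth_on_add smooth_on_mult smooth_on_sum smooth_on_const smooth_on_coordinate S)
  then have "smooth_on S (\<lambda>x. r\<^sup>2 - (norm (x - c))\<^sup>2)"
    by (simp add: power2_norm_eq_inner euclidean_inner[of "_ - c" "_ - c"])
  from smooth_on_compose[OF S open_UNIV smooth_on_flat this]
  show ?thesis by (simp add: bump_def[abs_def])
qed

subsection \<open>Hadamard's lemma\<close>

text \<open>Differentiating under the integral sign in direction \<open>v\<close> gives an integral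
  of the same kind, with \<open>f\<close> replaced by its derivative in direction \<open>v\<close>
  and \<open>w t\<close> by \<open>w t * t\<close>. The weight \<open>w\<close> is there to absorb
  this factor, so that the induction closes. Convexity keeps the segments from \<open>a\<close>
  inside \<open>S\<close>.\<close>

lemma Ck_on_average:
  fixes f :: "'a::euclidean_space \<Rightarrow> real"
  assumes "open S" "convex S" "a \<in> S" "continuous_on {0..1} w" "Ck_on k S f"
  shows "Ck_on k S (\<lambda>x. integral {0..1} (\<lambda>t. w t * f (a + t *\<^sub>R (x - a))))"
proof -
  have seg: "a + t *\<^sub>R (x - a) \<in> S" if "x \<in> S" "t \<in> {0..1}" for x and t :: real
    using convexD_alt[OF assms(2,3) that(1), of t] that(2) by (simp add: algebra_simps)
  have cont_seg: "continuous_on (S \<times> {0..1}) (\<lambda>z. u (a + snd z *\<^sub>R (fst z - a)))"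
    if "continuous_on S u" for u :: "'a \<Rightarrow> real"
  proof (rule continuous_on_compose2[OF that])
    show "continuous_on (S \<times> {0..1}) (\<lambda>z. a + snd z *\<^sub>R (fst z - a))"
      by (intro continuous_intros)
  qed (use seg in auto)
  have cont_snd: "continuous_on (S \<times> {0..1}) (\<lambda>z. w (snd z))"
    if "continuous_on {0..1} w" for w :: "real \<Rightarrow> real"
    by (rule continuous_on_compose2[OF that continuous_on_snd[OF continuous_on_id]]) auto
  show ?thesis
    using assms(4,5)
  proof (induction k arbitrary: f w)
    case 0
    have "continuous_on (S \<times> cbox 0 1) (\<lambda>(x, t). w t * f (a + t *\<^sub>R (x - a)))"
      using continuous_on_mult[OF cont_snd[OF 0(1)] cont_seg[of f]] 0(2) by (simp add: split_beta)
    from integral_continuous_on_param[OF this] show ?case by simp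
  next
    case (Suc k)
    have f_cont: "continuous_on S f"
      using Suc.prems(2) by (auto simp: differentiable_imp_continuous_on)
    have df_cont: "continuous_on S (\<lambda>x. frechet_derivative f (at x) i)" for i
      using Suc.prems(2) by (cases k) (auto simp: differentiable_imp_continuous_on)
    \<comment> \<open>The Leibniz rule asks for the derivative as a bounded linear map depending
      continuously on \<open>(x, t)\<close>. Assembled from its partial derivatives, its continuity
      reduces to that of scalar functions.\<close>
    define L where "L x t = (\<Sum>i\<in>Basis. (w t * t * frechet_derivative f (at (a + t *\<^sub>R (x - a))) i)
        *\<^sub>R (blinfun_inner_left i :: 'a \<Rightarrow>\<^sub>L real))" for x t
    have F_sum: "frechet_derivative f (at y) v = (\<Sum>i\<in>Basis. (v \<bullet> i) * frechet_derivative f (at y) i)"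
      if "y \<in> S" for y v
    proof -
      have "linear (frechet_derivative f (at y))"
        using Ck_on_has_derivative[OF assms(1) Suc.prems(2) that] has_derivative_linear by blast
      then have "frechet_derivative f (at y) (\<Sum>i\<in>Basis. (v \<bullet> i) *\<^sub>R i) =
          (\<Sum>i\<in>Basis. (v \<bullet> i) * frechet_derivative f (at y) i)"
        by (simp add: linear_sum linear_scale)
      then show ?thesis by (simp add: euclidean_representation)
    qed
    have L_apply: "blinfun_apply (L x t) v = w t * t * frechet_derivative f (at (a + t *\<^sub>R (x - a))) v"
      if "x \<in> S" "t \<in> {0..1}" for x t v
      unfolding L_def F_sum[OF seg[OF that], of v]
      by (simp add: blinfun.sum_left blinfun.scaleR_left sum_distrib_left mult_ac inner_commute)
    have L_cont: "continuous_on (S \<times> {0..1}) (\<lambda>z. L (fst z) (snd z))"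
      unfolding L_def
      by (intro continuous_on_sum continuous_on_scaleR continuous_on_mult cont_snd[OF Suc.prems(1)]
          cont_seg[OF df_cont] continuous_on_snd continuous_on_id continuous_on_const)
    have der: "((\<lambda>x. integral (cbox 0 1) (\<lambda>t. w t * f (a + t *\<^sub>R (x - a)))) has_derivative
        blinfun_apply (integral (cbox 0 1) (L x))) (at x within S)" if "x \<in> S" for x
    proof (rule leibniz_rule[OF _ _ _ that assms(2)])
      fix y and t :: real assume y: "y \<in> S" and t: "t \<in> cbox 0 1"
      have "((\<lambda>y. a + t *\<^sub>R (y - a)) has_derivative (\<lambda>v. t *\<^sub>R v)) (at y)"
        by (auto intro!: derivative_eq_intros)
      from has_derivative_compose[OF this
          Ck_on_has_derivative[OF assms(1) Suc.prems(2) seg[OF y]]]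
      have "((\<lambda>y. f (a + t *\<^sub>R (y - a))) has_derivative
          (\<lambda>v. frechet_derivative f (at (a + t *\<^sub>R (y - a))) (t *\<^sub>R v))) (at y)"
        using t by auto
      moreover have "frechet_derivative f (at (a + t *\<^sub>R (y - a))) (t *\<^sub>R v) =
          t * frechet_derivative f (at (a + t *\<^sub>R (y - a))) v" for v
        using t has_derivative_linear[OF Ck_on_has_derivative[OF assms(1) Suc.prems(2) seg[OF y]], of t]
        by (simp add: linear_scale)
      ultimately have "((\<lambda>y. w t * f (a + t *\<^sub>R (y - a))) has_derivative
          (\<lambda>v. w t * (t * frechet_derivative f (at (a + t *\<^sub>R (y - a))) v))) (at y)"
        by (auto intro: has_derivative_mult_right)
      moreover have "blinfun_apply (L y t) =
          (\<lambda>v. w t * (t * frechet_derivative f (at (a + t *\<^sub>R (y - a))) v))"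
        using L_apply[OF y] t by auto
      ultimately show "((\<lambda>y. w t * f (a + t *\<^sub>R (y - a))) has_derivative blinfun_apply (L y t))
          (at y within S)"
        by (simp add: has_derivative_at_withinI)
    next
      fix y assume y: "y \<in> S"
      have "continuous_on {0..1} (\<lambda>t. f (a + t *\<^sub>R (y - a)))"
      proof (rule continuous_on_compose2[OF f_cont])
        show "continuous_on {0..1} (\<lambda>t. a + t *\<^sub>R (y - a))" by (intro continuous_intros)
      qed (use seg y in auto)
      then show "(\<lambda>t. w t * f (a + t *\<^sub>R (y - a))) integrable_on cbox 0 1"
        using Suc.prems(1) by (intro integrable_continuous continuous_on_mult) auto
    qed (use L_cont in \<open>simp add: split_beta\<close>)
    have L_int: "blinfun_apply (integral (cbox 0 1) (L x)) v =
        integral {0..1} (\<lambda>t. w t * t * frechet_derivative f (at (a + t *\<^sub>R (x - a))) v)"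
      if "x \<in> S" for x v
    proof -
      have "continuous_on {0..1} (L x)"
        using continuous_on_compose2[OF L_cont continuous_on_Pair[OF continuous_on_const continuous_on_id],
            of x "{0..1}"] that by auto
      then have "L x integrable_on cbox 0 1" by (simp add: integrable_continuous_interval)
      then have "blinfun_apply (integral (cbox 0 1) (L x)) v = integral (cbox 0 1) (\<lambda>t. blinfun_apply (L x t) v)"
        using integral_linear[OF _ blinfun.bounded_linear_left, of "L x" "cbox 0 1" v]
        by (simp add: o_def)
      also have "\<dots> = integral {0..1} (\<lambda>t. w t * t * frechet_derivative f (at (a + t *\<^sub>R (x - a))) v)"
        by (auto intro!: integral_cong simp: L_apply[OF that])
      finally show ?thesis .
    qed
    show ?case
    proof (rule Ck_on_SucI[OF assms(1)])
      show "((\<lambda>x. integral {0..1} (\<lambda>t. w t * f (a + t *\<^sub>R (x - a)))) has_derivative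
          blinfun_apply (integral (cbox 0 1) (L x))) (at x)" if "x \<in> S" for x
        using der[OF that] at_within_open[OF that assms(1)] by simp
    next
      fix v
      have "Ck_on k S (\<lambda>x. integral {0..1}
          (\<lambda>t. (w t * t) * frechet_derivative f (at (a + t *\<^sub>R (x - a))) v))"
        by (rule Suc.IH) (use Suc.prems in \<open>auto intro!: continuous_intros\<close>)
      then show "Ck_on k S (\<lambda>x. blinfun_apply (integral (cbox 0 1) (L x)) v)"
        by (rule Ck_on_cong[OF assms(1), rotated]) (rule L_int[symmetric])
    qed
  qed
qed

text \<open>Integrate the derivative of \<open>f\<close> along the segment from \<open>a\<close> to
  \<open>x\<close> and expand \<open>x - a\<close> in \<open>Basis\<close>: \<open>h i x\<close> is
  the mean of the partial derivative in direction \<open>i\<close> along the segment. At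
  \<open>x = a\<close> the integrand is constant.\<close>

lemma hadamard:
  fixes f :: "'a::euclidean_space \<Rightarrow> real"
  assumes "open S" "convex S" "a \<in> S" "smooth_on S f"
  obtains h where "\<And>i. smooth_on S (h i)" "\<And>i. h i a = frechet_derivative f (at a) i"
    "\<And>x. x \<in> S \<Longrightarrow> f x = f a + (\<Sum>i\<in>Basis. ((x - a) \<bullet> i) * h i x)"
proof
  \<comment> \<open>The factor 1 is the initial weight for \<open>Ck_on_average\<close>.\<close>
  define h where "h i x = integral {0..1} (\<lambda>t. 1 * frechet_derivative f (at (a + t *\<^sub>R (x - a))) i)"
    for i x
  show "smooth_on S (h i)" for i
    unfolding smooth_on_def h_def
    by (intro allI Ck_on_average assms(1,2,3) continuous_on_const)
       (use smooth_on_frechet_derivative[OF assms(4), of i] in \<open>simp add: smooth_on_def\<close>)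
  show "h i a = frechet_derivative f (at a) i" for i
    by (simp add: h_def)
  fix x assume x: "x \<in> S"
  have seg: "a + t *\<^sub>R (x - a) \<in> S" if "t \<in> {0..1}" for t :: real
    using convexD_alt[OF assms(2,3) x, of t] that by (simp add: algebra_simps)
  let ?F = "\<lambda>t. frechet_derivative f (at (a + t *\<^sub>R (x - a)))"
  have F: "(f has_derivative ?F t) (at (a + t *\<^sub>R (x - a)))" if "t \<in> {0..1}" for t
    by (rule smooth_on_has_derivative[OF assms(1,4) seg[OF that]])
  have "((\<lambda>t. f (a + t *\<^sub>R (x - a))) has_vector_derivative ?F t (x - a)) (at t within {0..1})"
    if t: "t \<in> {0..1}" for t
  proof -
    have "((\<lambda>t. a + t *\<^sub>R (x - a)) has_derivative (\<lambda>s. s *\<^sub>R (x - a))) (at t within {0..1})"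
      by (auto intro!: derivative_eq_intros)
    from has_derivative_compose[OF this F[OF t]]
    show ?thesis
      using linear_scale[OF has_derivative_linear[OF F[OF t]]]
      by (simp add: has_vector_derivative_def)
  qed
  from fundamental_theorem_of_calculus[OF _ this]
  have "((\<lambda>t. ?F t (x - a)) has_integral f x - f a) {0..1}" by simp
  moreover have "((\<lambda>t. ?F t (x - a)) has_integral (\<Sum>i\<in>Basis. ((x - a) \<bullet> i) * h i x)) {0..1}"
  proof (rule has_integral_eq[rotated])
    show "((\<lambda>t. \<Sum>i\<in>Basis. ((x - a) \<bullet> i) * ?F t i) has_integral
        (\<Sum>i\<in>Basis. ((x - a) \<bullet> i) * h i x)) {0..1}"
    proof (intro has_integral_sum has_integral_mult_right finite_Basis)
      fix i
      have "continuous_on {0..1} (\<lambda>t. ?F t i)"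
      proof (rule continuous_on_compose2[OF smooth_on_imp_continuous_on[OF
                smooth_on_frechet_derivative[OF assms(4), of i]]])
        show "continuous_on {0..1} (\<lambda>t. a + t *\<^sub>R (x - a))" by (intro continuous_intros)
      qed (use seg in auto)
      then show "((\<lambda>t. ?F t i) has_integral h i x) {0..1}"
        unfolding h_def by (simp add: integrable_continuous_interval integrable_integral)
    qed
    fix t :: real assume "t \<in> {0..1}"
    from has_derivative_linear[OF F[OF this]]
    have "?F t (\<Sum>i\<in>Basis. ((x - a) \<bullet> i) *\<^sub>R i) = (\<Sum>i\<in>Basis. ((x - a) \<bullet> i) * ?F t i)"
      by (simp add: linear_sum linear_scale)
    then show "(\<Sum>i\<in>Basis. ((x - a) \<bullet> i) * ?F t i) = ?F t (x - a)"
      by (simp add: euclidean_representation)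
  qed
  ultimately have "f x - f a = (\<Sum>i\<in>Basis. ((x - a) \<bullet> i) * h i x)"
    by (rule has_integral_unique)
  then show "f x = f a + (\<Sum>i\<in>Basis. ((x - a) \<bullet> i) * h i x)" by simp
qed

section \<open>Smooth functions, tangent spaces and vector fields\<close>

lemma scaleR_fun_apply [simp]: "(r *\<^sub>R f) x = r *\<^sub>R f x"
  by (simp add: scaleR_fun_def)

lemma sum_fun_apply: "(\<Sum>i\<in>I. f i) x = (\<Sum>i\<in>I. f i x)"
  by (induction I rule: infinite_finite_induct) auto

lemma linear_on_add: "linear_on S F \<Longrightarrow> u \<in> S \<Longrightarrow> v \<in> S \<Longrightarrow> F (u + v) = F u + F v"
  by (simp add: linear_on_def)

lemma linear_on_scaleR: "linear_on S F \<Longrightarrow> u \<in> S \<Longrightarrow> F (r *\<^sub>R u) = r *\<^sub>R F u"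
  by (simp add: linear_on_def)

locale manifold =
  fixes A :: "('m::{t2_space, second_countable_topology}, 'e::euclidean_space) chart set"
  assumes manifold: "smooth_manifold A"
begin

abbreviation "C \<equiv> smooth_functions A"
abbreviation "T \<equiv> tangent_space A"
abbreviation "VF \<equiv> vector_fields A"

context
  fixes U :: "'m set" and \<kappa> :: "'m \<Rightarrow> 'e"
  assumes chart: "(U, \<kappa>) \<in> A"
begin

lemma open_chart: "open U"
  and open_chart_image: "open (\<kappa> ` U)"
  and homeomorphism_chart: "homeomorphism U (\<kappa> ` U) \<kappa> (inv_into U \<kappa>)"
  using manifold chart by (auto simp: smooth_manifold_def is_chart_def)

lemma inv_chart [simp]: "q \<in> U \<Longrightarrow> inv_into U \<kappa> (\<kappa> q) = q"
  using homeomorphism_chart by (simp add: homeomorphism_def)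

lemma continuous_on_inv_chart: "continuous_on (\<kappa> ` U) (inv_into U \<kappa>)"
  using homeomorphism_chart by (simp add: homeomorphism_def)

lemma continuous_on_chart: "continuous_on U \<kappa>"
  using homeomorphism_chart by (simp add: homeomorphism_def)

lemma open_chart_image_Int: "open W \<Longrightarrow> open (\<kappa> ` (U \<inter> W))"
proof -
  assume "open W"
  then have "open (\<kappa> ` U \<inter> inv_into U \<kappa> -` W)"
    using continuous_on_inv_chart open_chart_image by (simp add: continuous_on_open_vimage Int_commute)
  also have "\<kappa> ` U \<inter> inv_into U \<kappa> -` W = \<kappa> ` (U \<inter> W)" by auto
  finally show ?thesis .
qed

lemma smooth_on_transition: "(U', \<kappa>') \<in> A \<Longrightarrow> smooth_on (\<kappa> ` (U \<inter> U')) (\<kappa>' \<circ> inv_into U \<kappa>)"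
  using manifold chart by (auto simp: smooth_manifold_def)

lemma smooth_function_on_chart: "f \<in> C \<Longrightarrow> smooth_on (\<kappa> ` U) (f \<circ> inv_into U \<kappa>)"
  using chart by (auto simp: smooth_functions_def)

end

lemma obtain_chart: obtains U \<kappa> where "(U, \<kappa>) \<in> A" "p \<in> U"
proof -
  have "p \<in> (\<Union>(U, \<kappa>)\<in>A. U)" using manifold by (simp add: smooth_manifold_def)
  then show ?thesis using that by auto
qed

lemma smooth_functionI:
  "(\<And>U \<kappa>. (U, \<kappa>) \<in> A \<Longrightarrow> smooth_on (\<kappa> ` U) (\<lambda>x. f (inv_into U \<kappa> x))) \<Longrightarrow> f \<in> C"
  by (auto simp: smooth_functions_def o_def)

lemma smooth_functionD: "f \<in> C \<Longrightarrow> (U, \<kappa>) \<in> A \<Longrightarrow> smooth_on (\<kappa> ` U) (\<lambda>x. f (inv_into U \<kappa> x))"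
  using smooth_function_on_chart by (auto simp: o_def)

lemma smooth_function_const: "(\<lambda>_. c) \<in> C"
  by (rule smooth_functionI, intro smooth_on_const open_chart_image)

lemma smooth_function_add: "f \<in> C \<Longrightarrow> h \<in> C \<Longrightarrow> (\<lambda>x. f x + h x) \<in> C"
  by (rule smooth_functionI, intro smooth_on_add open_chart_image smooth_functionD)

lemma smooth_function_mult: "f \<in> C \<Longrightarrow> h \<in> C \<Longrightarrow> (\<lambda>x. f x * h x) \<in> C"
  by (rule smooth_functionI, intro smooth_on_mult open_chart_image smooth_functionD)

lemma smooth_function_diff: "f \<in> C \<Longrightarrow> h \<in> C \<Longrightarrow> (\<lambda>x. f x - h x) \<in> C"
  using smooth_function_add[OF _ smooth_function_mult[OF smooth_function_const[of "-1"]], of f h]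
  by simp

lemma smooth_function_sum: "(\<And>i. i \<in> I \<Longrightarrow> f i \<in> C) \<Longrightarrow> (\<lambda>x. \<Sum>i\<in>I. f i x) \<in> C"
  by (rule smooth_functionI, intro smooth_on_sum open_chart_image smooth_functionD)

lemma tangent_add: "v \<in> T p \<Longrightarrow> f \<in> C \<Longrightarrow> h \<in> C \<Longrightarrow> v (\<lambda>x. f x + h x) = v f + v h"
  using linear_on_add[of C v f h] by (simp add: tangent_space_def plus_fun_def)

lemma tangent_scale: "v \<in> T p \<Longrightarrow> f \<in> C \<Longrightarrow> v (\<lambda>x. c * f x) = c * v f"
  using linear_on_scaleR[of C v f c] by (simp add: tangent_space_def scaleR_fun_def)

lemma tangent_mult:
  "v \<in> T p \<Longrightarrow> f \<in> C \<Longrightarrow> h \<in> C \<Longrightarrow> v (\<lambda>x. f x * h x) = f p * v h + h p * v f"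
  by (auto simp: tangent_space_def times_fun_def)

lemma tangent_diff: "v \<in> T p \<Longrightarrow> f \<in> C \<Longrightarrow> h \<in> C \<Longrightarrow> v (\<lambda>x. f x - h x) = v f - v h"
  using tangent_add[of v p f "\<lambda>x. (-1) * h x"] tangent_scale[of v p h "-1"]
    smooth_function_mult[OF smooth_function_const[of "-1"], of h]
  by simp

lemma tangent_const: "v \<in> T p \<Longrightarrow> v (\<lambda>_. c) = 0"
proof -
  assume v: "v \<in> T p"
  have "v (\<lambda>_. 1) = 0" using tangent_mult[OF v smooth_function_const smooth_function_const, of 1 1] by simp
  then show ?thesis using tangent_scale[OF v smooth_function_const, of c 1] by simp
qed

lemma tangent_sum:
  assumes "v \<in> T p" "\<And>i. i \<in> I \<Longrightarrow> f i \<in> C"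
  shows "v (\<lambda>x. \<Sum>i\<in>I. f i x) = (\<Sum>i\<in>I. v (f i))"
  using assms(2)
proof (induction I rule: infinite_finite_induct)
  case (insert i I)
  then show ?case
    using tangent_add[OF assms(1), of "f i" "\<lambda>x. \<Sum>i\<in>I. f i x"] by (simp add: smooth_function_sum)
qed (simp_all add: tangent_const[OF assms(1)])

lemma tangent_nonsmooth: "v \<in> T p \<Longrightarrow> f \<notin> C \<Longrightarrow> v f = 0"
  by (simp add: tangent_space_def)

lemma tangentI:
  assumes "\<And>f h. f \<in> C \<Longrightarrow> h \<in> C \<Longrightarrow> v (\<lambda>x. f x + h x) = v f + v h"
    "\<And>f c. f \<in> C \<Longrightarrow> v (\<lambda>x. c * f x) = c * v f"
    "\<And>f h. f \<in> C \<Longrightarrow> h \<in> C \<Longrightarrow> v (\<lambda>x. f x * h x) = f p * v h + h p * v f"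
    "\<And>f. f \<notin> C \<Longrightarrow> v f = 0"
  shows "v \<in> T p"
  using assms by (auto simp: tangent_space_def linear_on_def plus_fun_def times_fun_def scaleR_fun_def)

lemma subspace_tangent: "subspace (T p)"
  by (auto simp: subspace_def tangent_space_def linear_on_def algebra_simps)

lemma vector_field_tangent: "X \<in> VF \<Longrightarrow> X p \<in> T p"
  by (simp add: vector_fields_def)

lemma vector_field_smooth: "X \<in> VF \<Longrightarrow> f \<in> C \<Longrightarrow> (\<lambda>p. X p f) \<in> C"
  by (simp add: vector_fields_def)

lemma vector_field_add: "X \<in> VF \<Longrightarrow> Y \<in> VF \<Longrightarrow> X + Y \<in> VF"
  by (auto simp: vector_fields_def intro: smooth_function_add subspace_add[OF subspace_tangent])

lemma vector_field_scale: "f \<in> C \<Longrightarrow> X \<in> VF \<Longrightarrow> (\<lambda>p. f p *\<^sub>R X p) \<in> VF"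
  by (auto simp: vector_fields_def intro: smooth_function_mult subspace_scale[OF subspace_tangent])

lemma vector_field_scaleR: "X \<in> VF \<Longrightarrow> c *\<^sub>R X \<in> VF"
  using vector_field_scale[OF smooth_function_const, of X c] by (simp add: scaleR_fun_def)

lemma vector_field_zero: "0 \<in> VF"
  by (auto simp: vector_fields_def smooth_function_const subspace_0[OF subspace_tangent])

lemma vector_field_diff: "X \<in> VF \<Longrightarrow> Y \<in> VF \<Longrightarrow> X - Y \<in> VF"
  using vector_field_add[OF _ vector_field_scaleR[of Y "-1"], of X] by simp

lemma vector_field_sum: "(\<And>i. i \<in> I \<Longrightarrow> X i \<in> VF) \<Longrightarrow> (\<Sum>i\<in>I. X i) \<in> VF"
  by (induction I rule: infinite_finite_induct) (simp_all add: vector_field_zero vector_field_add)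

end

subsection \<open>Coordinate vector fields\<close>

text \<open>Two radii are needed: the bump is supported on the closed ball of radius
  \<open>r\<close>, while the functions to be cut off live on the larger ball of radius
  \<open>r'\<close>. The gap makes the support a compact subset of the region where these functions
  are smooth, so that extension by 0 does no harm.\<close>

locale coordinate_ball = manifold +
  fixes U :: "'a set" and \<kappa> :: "'a \<Rightarrow> 'b" and c :: 'b and r r' :: real
  assumes chart: "(U, \<kappa>) \<in> A" and r: "0 < r" "r < r'" and ball_subset: "ball c r' \<subseteq> \<kappa> ` U"
begin

definition cutoff :: "('b \<Rightarrow> real) \<Rightarrow> 'a \<Rightarrow> real" where
  "cutoff F q = (if q \<in> U then bump c r (\<kappa> q) * F (\<kappa> q) else 0)"

lemma cutoff_eq_0: "\<not> (q \<in> U \<and> \<kappa> q \<in> ball c r) \<Longrightarrow> cutoff F q = 0"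
  using bump_eq_0[of r "\<kappa> q" c] r by (auto simp: cutoff_def)

text \<open>Let \<open>K\<close> be the part of the manifold over the closed ball of radius
  \<open>r\<close>. Near a point of \<open>K\<close> the function is \<open>bump c r * F\<close>
  composed with a smooth chart transition; off \<open>K\<close> it is 0. The complement of
  \<open>K\<close> is open because a compact set in a Hausdorff space is closed, also relative to
  points outside the chart.\<close>

lemma smooth_cutoff:
  assumes F: "smooth_on (ball c r') F"
  shows "cutoff F \<in> C"
proof (rule smooth_functionI)
  fix U' \<kappa>' assume chart': "(U', \<kappa>') \<in> A"
  let ?g = "\<lambda>x. cutoff F (inv_into U' \<kappa>' x)"
  have cball: "cball c r \<subseteq> \<kappa> ` U" using r ball_subset by (force simp: subset_iff)
  define K where "K = inv_into U \<kappa> ` cball c r"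
  have "compact K"
    unfolding K_def using continuous_on_subset[OF continuous_on_inv_chart[OF chart] cball]
    by (intro compact_continuous_image compact_cball)
  then have "closed K" by (rule compact_imp_closed)
  show "smooth_on (\<kappa>' ` U') ?g"
  proof (rule smooth_on_local)
    fix x assume "x \<in> \<kappa>' ` U'"
    then obtain q where q: "q \<in> U'" "x = \<kappa>' q" by auto
    show "\<exists>N. open N \<and> x \<in> N \<and> smooth_on N ?g"
    proof (cases "q \<in> K")
      case True
      define W where "W = U \<inter> \<kappa> -` ball c r'"
      have W: "open W"
        unfolding W_def using continuous_on_chart[OF chart] open_chart[OF chart]
        by (metis Int_commute continuous_on_open_vimage open_ball)
      from True cball r have "q \<in> W"
        by (force simp: K_def W_def f_inv_into_f inv_into_into)
      let ?N = "\<kappa>' ` (U' \<inter> W)"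
      have N: "open ?N" by (rule open_chart_image_Int[OF chart' W])
      have "smooth_on ?N (\<kappa> \<circ> inv_into U' \<kappa>')"
        by (rule smooth_on_subset[OF smooth_on_transition[OF chart' chart]]) (auto simp: W_def)
      moreover have "smooth_on (ball c r') (\<lambda>y. bump c r y * F y)"
        by (intro smooth_on_mult smooth_on_bump F open_ball)
      moreover have "(\<kappa> \<circ> inv_into U' \<kappa>') ` ?N \<subseteq> ball c r'"
        by (auto simp: W_def inv_chart[OF chart'])
      ultimately have "smooth_on ?N (\<lambda>x. (\<lambda>y. bump c r y * F y) ((\<kappa> \<circ> inv_into U' \<kappa>') x))"
        using smooth_on_compose[OF N open_ball] by blast
      then have "smooth_on ?N ?g"
        by (rule smooth_on_cong[OF N, rotated])
           (auto simp: cutoff_def W_def inv_chart[OF chart'])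
      then show ?thesis using N q \<open>q \<in> W\<close> by blast
    next
      case False
      let ?N = "\<kappa>' ` (U' \<inter> - K)"
      have N: "open ?N" using open_chart_image_Int[OF chart'] \<open>closed K\<close> by blast
      have "cutoff F q' = 0" if "q' \<notin> K" for q'
      proof (rule cutoff_eq_0, rule notI)
        assume q': "q' \<in> U \<and> \<kappa> q' \<in> ball c r"
        then have "inv_into U \<kappa> (\<kappa> q') \<in> K"
          unfolding K_def by (intro imageI) auto
        with that q' show False by (simp add: inv_chart[OF chart])
      qed
      then have "smooth_on ?N ?g"
        by (intro smooth_on_cong[OF N _ smooth_on_const[OF N, of 0]])
           (auto simp: inv_chart[OF chart'])
      then show ?thesis using N q False by blast
    qed
  qed
qed

definition \<psi> :: "'a \<Rightarrow> real" where "\<psi> = cutoff (\<lambda>_. 1)"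

text \<open>On \<open>U\<close> this is \<open>\<psi>\<close> times the coordinate, not the
  coordinate itself. Thus \<open>coord i - (\<kappa> q \<bullet> i) * \<psi>\<close> is a global
  smooth function vanishing at \<open>q\<close>, and it takes the place of the coordinate
  difference.\<close>

definition coord :: "'b \<Rightarrow> 'a \<Rightarrow> real" where "coord i = cutoff (\<lambda>y. y \<bullet> i)"

lemma \<psi>_pos: "q \<in> U \<Longrightarrow> \<kappa> q \<in> ball c r \<Longrightarrow> \<psi> q > 0"
  by (simp add: \<psi>_def cutoff_def bump_pos)

lemma smooth_\<psi>: "\<psi> \<in> C"
  unfolding \<psi>_def by (intro smooth_cutoff smooth_on_const open_ball)

lemma smooth_coord: "coord i \<in> C"
  unfolding coord_def
  by (intro smooth_cutoff smooth_on_bounded_linear bounded_linear_inner_left open_ball)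

lemma cutoff_mult: "cutoff F q = \<psi> q * F (\<kappa> q)" if "q \<in> U"
  using that by (simp add: \<psi>_def cutoff_def)

definition partial :: "'b \<Rightarrow> 'a \<Rightarrow> ('a \<Rightarrow> real) \<Rightarrow> real" where
  "partial i q f = frechet_derivative (f \<circ> inv_into U \<kappa>) (at (\<kappa> q)) i"

lemma smooth_on_ball: "f \<in> C \<Longrightarrow> smooth_on (ball c r') (f \<circ> inv_into U \<kappa>)"
  using smooth_on_subset[OF smooth_function_on_chart[OF chart] ball_subset] .

text \<open>Multiplying Hadamard's expansion \<open>f = f q + (\<Sum>i. (y - \<kappa> q)\<^sub>i h\<^sub>i)\<close> by \<open>\<psi>\<^sup>2\<close> turns it into an
  identity between globally smooth functions, to which a derivation can be applied.\<close>

lemma tangent_expansion: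
  assumes q: "q \<in> U" "\<kappa> q \<in> ball c r" and v: "v \<in> T q" and f: "f \<in> C"
  shows "\<psi> q * v f = (\<Sum>i\<in>Basis. (v (coord i) - (\<kappa> q \<bullet> i) * v \<psi>) * partial i q f)"
proof -
  have \<kappa>q: "\<kappa> q \<in> ball c r'" using q r by auto
  obtain h where h: "\<And>i. smooth_on (ball c r') (h i)"
    "\<And>i. h i (\<kappa> q) = partial i q f"
    "\<And>y. y \<in> ball c r' \<Longrightarrow> (f \<circ> inv_into U \<kappa>) y =
      (f \<circ> inv_into U \<kappa>) (\<kappa> q) + (\<Sum>i\<in>Basis. ((y - \<kappa> q) \<bullet> i) * h i y)"
    by (rule hadamard[OF open_ball convex_ball \<kappa>q smooth_on_ball[OF f],
          folded partial_def]) (rule that; simp)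
  have H: "cutoff (h i) \<in> C" for i
    by (rule smooth_cutoff[OF h(1)])
  have X: "(\<lambda>x. coord i x - (\<kappa> q \<bullet> i) * \<psi> x) \<in> C" for i
    by (intro smooth_function_diff smooth_function_mult smooth_coord smooth_function_const smooth_\<psi>)
  note smooth = smooth_function_mult smooth_function_add smooth_function_sum smooth_function_const
    smooth_\<psi> f X H
  \<comment> \<open>One factor \<open>\<psi>\<close> is spent on the coordinate difference, the
    other on the Hadamard coefficient \<open>h i\<close>; off the small ball every term is
    0.\<close>
  have expansion: "\<psi> x * (\<psi> x * f x) = f q * (\<psi> x * \<psi> x) +
      (\<Sum>i\<in>Basis. (coord i x - (\<kappa> q \<bullet> i) * \<psi> x) * cutoff (h i) x)" for x
  proof (cases "x \<in> U \<and> \<kappa> x \<in> ball c r")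
    case True
    then have "\<kappa> x \<in> ball c r'" using r by auto
    from h(3)[OF this] True q have fx: "f x = f q + (\<Sum>i\<in>Basis. ((\<kappa> x - \<kappa> q) \<bullet> i) * h i (\<kappa> x))"
      by (simp add: inv_chart[OF chart])
    have "(\<Sum>i\<in>Basis. (coord i x - (\<kappa> q \<bullet> i) * \<psi> x) * cutoff (h i) x) =
        \<psi> x * \<psi> x * (\<Sum>i\<in>Basis. ((\<kappa> x - \<kappa> q) \<bullet> i) * h i (\<kappa> x))"
      unfolding sum_distrib_left using True
      by (intro sum.cong refl) (simp add: coord_def cutoff_mult inner_diff_left algebra_simps)
    then show ?thesis
      by (subst fx) (simp add: algebra_simps)
  next
    case False
    then show ?thesis by (simp add: \<psi>_def coord_def cutoff_eq_0)
  qed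
  have "v (\<lambda>x. \<psi> x * (\<psi> x * f x)) = \<psi> q * (\<psi> q * v f + f q * v \<psi>) + \<psi> q * f q * v \<psi>"
    by (simp add: tangent_mult[OF v] smooth)
  moreover have "v (\<lambda>x. \<psi> x * (\<psi> x * f x)) = f q * (2 * \<psi> q * v \<psi>) +
      (\<Sum>i\<in>Basis. v (\<lambda>x. (coord i x - (\<kappa> q \<bullet> i) * \<psi> x) * cutoff (h i) x))"
    unfolding expansion
    by (subst tangent_add[OF v], intro smooth, intro smooth, subst tangent_sum[OF v], intro smooth,
        subst tangent_scale[OF v], intro smooth)
       (simp add: tangent_mult[OF v smooth_\<psi> smooth_\<psi>])
  \<comment> \<open>The first factor vanishes at \<open>q\<close>, so the Leibniz rule keeps only
    its derivative, multiplied by the value of \<open>cutoff (h i)\<close> at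
    \<open>q\<close>.\<close>
  moreover have "v (\<lambda>x. (coord i x - (\<kappa> q \<bullet> i) * \<psi> x) * cutoff (h i) x) =
      \<psi> q * ((v (coord i) - (\<kappa> q \<bullet> i) * v \<psi>) * partial i q f)" for i
  proof -
    have "v (\<lambda>x. coord i x - (\<kappa> q \<bullet> i) * \<psi> x) = v (coord i) - (\<kappa> q \<bullet> i) * v \<psi>"
      by (simp add: tangent_diff[OF v] tangent_scale[OF v] smooth smooth_coord)
    moreover have "coord i q = \<psi> q * (\<kappa> q \<bullet> i)" "cutoff (h i) q = \<psi> q * partial i q f"
      using q(1) by (simp_all add: cutoff_mult coord_def h(2))
    ultimately show ?thesis by (simp add: tangent_mult[OF v X H])
  qed
  moreover define S where "S = (\<Sum>i\<in>Basis. (v (coord i) - (\<kappa> q \<bullet> i) * v \<psi>) * partial i q f)"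
  ultimately have "\<psi> q * (\<psi> q * v f + f q * v \<psi>) + \<psi> q * f q * v \<psi> =
      f q * (2 * \<psi> q * v \<psi>) + \<psi> q * S"
    by (simp only: sum_distrib_left)
  then have "\<psi> q * (\<psi> q * v f) = \<psi> q * S" by (simp add: algebra_simps)
  then show ?thesis using \<psi>_pos[OF q] by (simp add: S_def)
qed

text \<open>The factor \<open>\<psi>\<close> lets the coordinate field of the chart extend by zero
  to the whole manifold. The value 0 on nonsmooth \<open>f\<close> is the convention built into
  \<open>tangent_space\<close>.\<close>

definition coord_field :: "'b \<Rightarrow> 'a vector_field" where
  "coord_field i q f = (if q \<in> U \<and> f \<in> C then \<psi> q * partial i q f else 0)"

lemma chart_has_derivative:
  "q \<in> U \<Longrightarrow> f \<in> C \<Longrightarrow> ((f \<circ> inv_into U \<kappa>) has_derivative (\<lambda>i. partial i q f)) (at (\<kappa> q))"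
  using smooth_on_has_derivative[OF open_chart_image[OF chart] smooth_function_on_chart[OF chart]]
  by (simp add: partial_def)

lemma partial_eqI:
  "((f \<circ> inv_into U \<kappa>) has_derivative f') (at (\<kappa> q)) \<Longrightarrow> partial i q f = f' i"
  by (simp add: partial_def frechet_derivative_at[symmetric])

lemma vector_field_coord_field: "coord_field i \<in> VF"
  unfolding vector_fields_def
proof (intro CollectI conjI allI ballI)
  fix q
  show "coord_field i q \<in> T q"
  proof (cases "q \<in> U")
    case False
    then have "coord_field i q = 0" by (auto simp: coord_field_def)
    then show ?thesis using subspace_0[OF subspace_tangent] by simp
  next
    case True
    show ?thesis
    proof (rule tangentI)
      fix f h assume f: "f \<in> C" and h: "h \<in> C"
      note D = chart_has_derivative[OF True f] chart_has_derivative[OF True h]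
      have "partial i q (\<lambda>x. f x + h x) = partial i q f + partial i q h"
        using has_derivative_add[OF D] by (intro partial_eqI) (simp add: o_def)
      then show "coord_field i q (\<lambda>x. f x + h x) = coord_field i q f + coord_field i q h"
        using f h by (simp add: coord_field_def smooth_function_add algebra_simps)
      have "partial i q (\<lambda>x. f x * h x) = f q * partial i q h + partial i q f * h q"
        using has_derivative_mult[OF D] True
        by (intro partial_eqI) (simp add: o_def inv_chart[OF chart])
      then show "coord_field i q (\<lambda>x. f x * h x) = f q * coord_field i q h + h q * coord_field i q f"
        using f h by (simp add: coord_field_def smooth_function_mult algebra_simps)
    next
      fix f a assume f: "f \<in> C"
      have "partial i q (\<lambda>x. a * f x) = a * partial i q f"
        using has_derivative_mult_right[OF chart_has_derivative[OF True f], of a]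
        by (intro partial_eqI) (simp add: o_def)
      then show "coord_field i q (\<lambda>x. a * f x) = a * coord_field i q f"
        using f smooth_function_mult[OF smooth_function_const[of a] f] by (simp add: coord_field_def)
    qed (simp add: coord_field_def)
  qed
next
  fix f assume f: "f \<in> C"
  have "(\<lambda>q. coord_field i q f) = cutoff (\<lambda>y. frechet_derivative (f \<circ> inv_into U \<kappa>) (at y) i)"
    using f by (auto simp: coord_field_def cutoff_def \<psi>_def partial_def)
  then show "(\<lambda>q. coord_field i q f) \<in> C"
    using smooth_cutoff[OF smooth_on_frechet_derivative[OF smooth_on_ball[OF f]]] by simp
qed

text \<open>One factor \<open>\<psi> q\<close> comes from \<open>tangent_expansion\<close>, the
  second from the one contained in \<open>coord_field\<close>.\<close>

lemma tangent_eq_coord_fields: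
  assumes q: "q \<in> U" "\<kappa> q \<in> ball c r" and v: "v \<in> T q"
  shows "(\<psi> q)\<^sup>2 *\<^sub>R v = (\<Sum>i\<in>Basis. (v (coord i) - (\<kappa> q \<bullet> i) * v \<psi>) *\<^sub>R coord_field i q)"
proof
  fix f
  show "((\<psi> q)\<^sup>2 *\<^sub>R v) f =
      (\<Sum>i\<in>Basis. (v (coord i) - (\<kappa> q \<bullet> i) * v \<psi>) *\<^sub>R coord_field i q) f"
  proof (cases "f \<in> C")
    case True
    have "((\<psi> q)\<^sup>2 *\<^sub>R v) f = \<psi> q * (\<psi> q * v f)" by (simp add: power2_eq_square)
    then show ?thesis
      using q True unfolding tangent_expansion[OF q v True]
      by (simp add: sum_fun_apply coord_field_def sum_distrib_left mult.left_commute)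
  next
    case False
    then show ?thesis by (simp add: sum_fun_apply coord_field_def tangent_nonsmooth[OF v])
  qed
qed

text \<open>The third factor \<open>\<psi> q\<close> turns the coordinate
  \<open>\<kappa> q \<bullet> i\<close>, meaningful only in the chart, into
  \<open>coord i q\<close>. The coefficients thereby become global smooth functions, and they vanish
  wherever \<open>X\<close> does.\<close>

lemma vector_field_eq_coord_fields:
  assumes X: "X \<in> VF"
  shows "(\<lambda>q. (\<psi> q * \<psi> q * \<psi> q) *\<^sub>R X q) =
    (\<Sum>i\<in>Basis. (\<lambda>q. (\<psi> q * X q (coord i) - coord i q * X q \<psi>) *\<^sub>R coord_field i q))"
proof
  fix q
  show "(\<psi> q * \<psi> q * \<psi> q) *\<^sub>R X q =
    (\<Sum>i\<in>Basis. (\<lambda>q. (\<psi> q * X q (coord i) - coord i q * X q \<psi>) *\<^sub>R coord_field i q)) q"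
  proof (cases "q \<in> U \<and> \<kappa> q \<in> ball c r")
    case True
    then have "\<psi> q *\<^sub>R ((\<psi> q)\<^sup>2 *\<^sub>R X q) =
        (\<Sum>i\<in>Basis. \<psi> q *\<^sub>R (X q (coord i) - (\<kappa> q \<bullet> i) * X q \<psi>) *\<^sub>R coord_field i q)"
      using tangent_eq_coord_fields[OF _ _ vector_field_tangent[OF X], of q]
      by (simp add: scaleR_sum_right)
    then show ?thesis
      using True by (simp add: sum_fun_apply coord_def cutoff_mult power2_eq_square algebra_simps)
  next
    case False
    then have "\<psi> q = 0" "coord i q = 0" for i by (simp_all add: \<psi>_def coord_def cutoff_eq_0)
    then show ?thesis by (simp add: sum_fun_apply)
  qed
qed

text \<open>The relation is tested on the cut-off coordinate \<open>j\<close> centred at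
  \<open>\<kappa> q\<close>. Centring makes the term with the derivative of the bump drop out, so
  \<open>coord_field i\<close> yields \<open>\<psi> q * \<psi> q\<close> for \<open>i = j\<close>
  and 0 for the other basis vectors.\<close>

lemma coord_field_independent:
  assumes q: "q \<in> U" "\<kappa> q \<in> ball c r" and zero: "(\<Sum>i\<in>Basis. a i *\<^sub>R coord_field i q) = 0"
    and j: "j \<in> Basis"
  shows "a j = 0"
proof -
  define z where "z = cutoff (\<lambda>y. (y - \<kappa> q) \<bullet> j)"
  have z: "z \<in> C" unfolding z_def by (intro smooth_cutoff smooth_on_coordinate open_ball)
  have "partial i q z = \<psi> q * (i \<bullet> j)" for i
  proof (rule partial_eqI)
    let ?D = "frechet_derivative (bump c r) (at (\<kappa> q))"
    have "(bump c r has_derivative ?D) (at (\<kappa> q))"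
      by (rule smooth_on_has_derivative[OF open_UNIV smooth_on_bump[OF open_UNIV] UNIV_I])
    moreover have "((\<lambda>y. (y - \<kappa> q) \<bullet> j) has_derivative (\<lambda>i. i \<bullet> j)) (at (\<kappa> q))"
      by (auto intro!: derivative_eq_intros)
    ultimately have "((\<lambda>y. bump c r y * ((y - \<kappa> q) \<bullet> j)) has_derivative
        (\<lambda>i. bump c r (\<kappa> q) * (i \<bullet> j) + ?D i * ((\<kappa> q - \<kappa> q) \<bullet> j))) (at (\<kappa> q))"
      by (rule has_derivative_mult)
    moreover have "(\<lambda>i. bump c r (\<kappa> q) * (i \<bullet> j) + ?D i * ((\<kappa> q - \<kappa> q) \<bullet> j)) = (\<lambda>i. \<psi> q * (i \<bullet> j))"
      using q by (simp add: \<psi>_def cutoff_def)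
    ultimately have "((\<lambda>y. bump c r y * ((y - \<kappa> q) \<bullet> j)) has_derivative (\<lambda>i. \<psi> q * (i \<bullet> j)))
        (at (\<kappa> q))" by simp
    then show "((z \<circ> inv_into U \<kappa>) has_derivative (\<lambda>i. \<psi> q * (i \<bullet> j))) (at (\<kappa> q))"
      by (rule has_derivative_transform_within_open[OF _ open_chart_image[OF chart]])
         (use q in \<open>auto simp: z_def cutoff_def inv_chart[OF chart]\<close>)
  qed
  then have field_z: "coord_field i q z = \<psi> q * \<psi> q * (i \<bullet> j)" for i
    using q z by (simp add: coord_field_def)
  have "0 = (\<Sum>i\<in>Basis. a i *\<^sub>R coord_field i q) z" by (simp add: zero)
  also have "\<dots> = (\<Sum>i\<in>Basis. if i = j then a j * (\<psi> q * \<psi> q) else 0)"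
    unfolding sum_fun_apply
    by (rule sum.cong) (use j in \<open>auto simp: field_z inner_Basis\<close>)
  also have "\<dots> = a j * (\<psi> q * \<psi> q)" using j by (simp add: sum.delta)
  finally show ?thesis using \<psi>_pos[OF q] by simp
qed

lemma dim_tangent_coordinate_ball:
  assumes q: "q \<in> U" "\<kappa> q \<in> ball c r"
  obtains B where "finite B" "independent B" "span B = T q" "card B = DIM('b)"
proof
  let ?E = "\<lambda>i. coord_field i q"
  have inj: "inj_on ?E Basis"
  proof (rule inj_onI, rule ccontr)
    fix i j :: 'b assume ij: "i \<in> Basis" "j \<in> Basis" "?E i = ?E j" "i \<noteq> j"
    have "(\<Sum>k\<in>Basis. (if k = i then 1 else if k = j then -1 else 0) *\<^sub>R ?E k) =
        (\<Sum>k\<in>{i,j}. (if k = i then 1 else if k = j then -1 else 0) *\<^sub>R ?E k)"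
      using ij by (intro sum.mono_neutral_right) auto
    also have "\<dots> = 0" using ij by simp
    finally have "(\<Sum>k\<in>Basis. (if k = i then 1 else if k = j then -1 else 0) *\<^sub>R ?E k) = 0" .
    from coord_field_independent[OF q this ij(1)] show False by simp
  qed
  show "finite (?E ` Basis)" by simp
  show "card (?E ` Basis) = DIM('b)" by (rule card_image[OF inj])
  show "independent (?E ` Basis)"
  proof
    assume "dependent (?E ` Basis)"
    then obtain a x where zero: "(\<Sum>x\<in>?E ` Basis. a x *\<^sub>R x) = 0"
      and x: "x \<in> ?E ` Basis" "a x \<noteq> 0"
      using real_vector.dependent_finite[of "?E ` Basis"] by auto
    from x(1) obtain j where j: "j \<in> Basis" "x = ?E j" by auto
    have "(\<Sum>i\<in>Basis. a (?E i) *\<^sub>R ?E i) = 0"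
      using zero by (simp only: sum.reindex[OF inj] o_def)
    from coord_field_independent[OF q this j(1)] j(2) x(2) show False by simp
  qed
  show "span (?E ` Basis) = T q"
  proof
    show "span (?E ` Basis) \<subseteq> T q"
      by (rule span_minimal[OF _ subspace_tangent])
         (auto intro: vector_field_tangent vector_field_coord_field)
    show "T q \<subseteq> span (?E ` Basis)"
    proof
      fix v assume "v \<in> T q"
      then have "(\<psi> q)\<^sup>2 *\<^sub>R v \<in> span (?E ` Basis)"
        unfolding tangent_eq_coord_fields[OF q \<open>v \<in> T q\<close>]
        by (intro span_sum span_scale span_base imageI)
      from span_scale[OF this, of "inverse ((\<psi> q)\<^sup>2)"] show "v \<in> span (?E ` Basis)"
        using \<psi>_pos[OF q] by simp
    qed
  qed
qed

end

section \<open>Bases of tangent spaces, extension to vector fields, tensoriality\<close>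

context manifold
begin

lemma obtain_coordinate_ball:
  obtains U \<kappa> r r' where "coordinate_ball A U \<kappa> (\<kappa> p) r r'" "p \<in> U"
proof -
  obtain U \<kappa> where chart: "(U, \<kappa>) \<in> A" and p: "p \<in> U" using obtain_chart .
  obtain r where "r > 0" "ball (\<kappa> p) r \<subseteq> \<kappa> ` U"
    using open_chart_image[OF chart] p by (meson imageI open_contains_ball)
  then have "coordinate_ball A U \<kappa> (\<kappa> p) (r / 2) r"
    using chart by unfold_locales auto
  then show thesis using p that by blast
qed

lemma tangent_basis:
  obtains B where "finite B" "independent B" "span B = T p" "card B = DIM('e)"
proof -
  obtain U \<kappa> r r' where b: "coordinate_ball A U \<kappa> (\<kappa> p) r r'" "p \<in> U" using obtain_coordinate_ball .
  interpret coordinate_ball A U \<kappa> "\<kappa> p" r r' by fact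
  show thesis using dim_tangent_coordinate_ball[of p] b(2) r that by auto
qed

lemma vector_field_through:
  assumes u: "u \<in> T p"
  obtains X where "X \<in> VF" "X p = u"
proof -
  obtain U \<kappa> r r' where b: "coordinate_ball A U \<kappa> (\<kappa> p) r r'" "p \<in> U" using obtain_coordinate_ball .
  interpret coordinate_ball A U \<kappa> "\<kappa> p" r r' by fact
  \<comment> \<open>The coefficients of \<open>u\<close> in the coordinate fields at
    \<open>p\<close> are kept constant over the manifold.\<close>
  let ?X = "inverse ((\<psi> p)\<^sup>2) *\<^sub>R (\<Sum>i\<in>Basis. (u (coord i) - (\<kappa> p \<bullet> i) * u \<psi>) *\<^sub>R coord_field i)"
  have "?X \<in> VF" by (intro vector_field_scaleR vector_field_sum vector_field_coord_field)
  moreover have "?X p = u"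
    using tangent_eq_coord_fields[OF b(2) _ u] r \<psi>_pos[OF b(2)]
    by (simp add: sum_fun_apply[of _ _ p] tangent_eq_coord_fields[OF b(2) _ u, symmetric])
  ultimately show thesis using that by blast
qed

lemma extension: "u \<in> T p \<Longrightarrow> extension A p u \<in> VF \<and> extension A p u p = u"
proof -
  assume "u \<in> T p"
  then obtain X where "X \<in> VF" "X p = u" by (rule vector_field_through)
  then have "\<exists>X. X \<in> VF \<and> X p = u" by blast
  then show ?thesis unfolding extension_def by (rule someI_ex)
qed

text \<open>\<open>G\<close> stands for an expression evaluated at \<open>p\<close>, such as
  \<open>\<lambda>U. R U V W p\<close>; hence \<open>f p\<close> in \<open>scale\<close>. Applied to
  the expansion in \<open>vector_field_eq_coord_fields\<close> it gives 0, since each coefficient is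
  built from \<open>X p\<close> acting on a fixed function, and the cube of \<open>\<psi> p\<close>
  can be cancelled.\<close>

lemma tensorial_vanishing:
  fixes G :: "'m vector_field \<Rightarrow> 'c::real_vector"
  assumes add: "\<And>X Y. X \<in> VF \<Longrightarrow> Y \<in> VF \<Longrightarrow> G (X + Y) = G X + G Y"
    and scale: "\<And>f X. f \<in> C \<Longrightarrow> X \<in> VF \<Longrightarrow> G (\<lambda>q. f q *\<^sub>R X q) = f p *\<^sub>R G X"
    and X: "X \<in> VF" and zero: "X p = 0"
  shows "G X = 0"
proof -
  obtain U \<kappa> r r' where b: "coordinate_ball A U \<kappa> (\<kappa> p) r r'" "p \<in> U" using obtain_coordinate_ball .
  interpret coordinate_ball A U \<kappa> "\<kappa> p" r r' by fact
  have G0: "G 0 = 0" using add[OF vector_field_zero vector_field_zero] by simp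
  have G_sum: "G (\<Sum>i\<in>I. Z i) = (\<Sum>i\<in>I. G (Z i))" if "\<And>i. Z i \<in> VF" for Z and I :: "'e set"
  proof (induction I rule: infinite_finite_induct)
    case (insert i I)
    have "G (Z i + (\<Sum>i\<in>I. Z i)) = G (Z i) + G (\<Sum>i\<in>I. Z i)"
      by (intro add vector_field_sum that)
    with insert show ?case by (simp only: sum.insert not_False_eq_True)
  qed (simp_all only: G0 sum.infinite sum.empty not_False_eq_True)
  have smooth: "(\<lambda>q. \<psi> q * X q (coord i) - coord i q * X q \<psi>) \<in> C" for i
    by (intro smooth_function_diff smooth_function_mult smooth_\<psi> smooth_coord vector_field_smooth[OF X])
  have "(\<psi> p * \<psi> p * \<psi> p) *\<^sub>R G X = G (\<lambda>q. (\<psi> q * \<psi> q * \<psi> q) *\<^sub>R X q)"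
    by (rule scale[symmetric]) (intro smooth_function_mult smooth_\<psi> X)+
  also have "\<dots> = (\<Sum>i\<in>Basis. G (\<lambda>q. (\<psi> q * X q (coord i) - coord i q * X q \<psi>) *\<^sub>R coord_field i q))"
    unfolding vector_field_eq_coord_fields[OF X]
    by (rule G_sum) (intro vector_field_scale smooth vector_field_coord_field)
  also have "\<dots> = 0"
    by (intro sum.neutral ballI) (simp add: scale[OF smooth vector_field_coord_field] zero)
  finally show ?thesis using \<psi>_pos[of p] b(2) r by auto
qed

lemma tensorial_eq:
  fixes G :: "'m vector_field \<Rightarrow> 'c::real_vector"
  assumes add: "\<And>X Y. X \<in> VF \<Longrightarrow> Y \<in> VF \<Longrightarrow> G (X + Y) = G X + G Y"
    and scale: "\<And>f X. f \<in> C \<Longrightarrow> X \<in> VF \<Longrightarrow> G (\<lambda>q. f q *\<^sub>R X q) = f p *\<^sub>R G X"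
    and "X \<in> VF" "Y \<in> VF" "X p = Y p"
  shows "G X = G Y"
proof -
  have "G (X - Y) = 0"
    by (rule tensorial_vanishing[where G = G and p = p]) (use assms in \<open>auto intro: vector_field_diff\<close>)
  moreover have "G ((X - Y) + Y) = G (X - Y) + G Y"
    by (intro add vector_field_diff assms)
  ultimately show ?thesis by simp
qed

end

section \<open>The curvature of the Levi-Civita connection\<close>

definition fmult :: "('m \<Rightarrow> real) \<Rightarrow> 'm vector_field \<Rightarrow> 'm vector_field" where
  "fmult f X = (\<lambda>p. f p *\<^sub>R X p)"

lemma fmult_apply [simp]: "fmult f X p = f p *\<^sub>R X p"
  by (simp add: fmult_def)

locale levi_civita_manifold = manifold A
  for A :: "('m::{t2_space, second_countable_topology}, 'e::euclidean_space) chart set" +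
  fixes g :: "'m \<Rightarrow> 'm tangent_vector \<Rightarrow> 'm tangent_vector \<Rightarrow> real"
    and D :: "'m vector_field \<Rightarrow> 'm vector_field \<Rightarrow> 'm vector_field"
  assumes metric: "pseudo_riemannian_metric A g" and levi_civita: "levi_civita A g D"
begin

lemma metric_linear: "u \<in> T p \<Longrightarrow> linear_on (T p) (g p u)"
  and metric_sym: "u \<in> T p \<Longrightarrow> v \<in> T p \<Longrightarrow> g p u v = g p v u"
  and metric_nondegenerate: "u \<in> T p \<Longrightarrow> (\<And>v. v \<in> T p \<Longrightarrow> g p u v = 0) \<Longrightarrow> u = 0"
  and metric_smooth: "X \<in> VF \<Longrightarrow> Y \<in> VF \<Longrightarrow> (\<lambda>p. g p (X p) (Y p)) \<in> C"
  using metric by (auto simp: pseudo_riemannian_metric_def)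

lemma metric_diff_right:
  "u \<in> T p \<Longrightarrow> v \<in> T p \<Longrightarrow> w \<in> T p \<Longrightarrow> g p u (v - w) = g p u v - g p u w"
  using linear_on_add[OF metric_linear, of u p v "(-1) *\<^sub>R w"] linear_on_scaleR[OF metric_linear, of u p w "-1"]
    subspace_scale[OF subspace_tangent, of w p "-1"] by simp

lemma metric_diff_left:
  "u \<in> T p \<Longrightarrow> v \<in> T p \<Longrightarrow> w \<in> T p \<Longrightarrow> g p (v - w) u = g p v u - g p w u"
  using metric_diff_right[of u p v w] metric_sym[of u p] subspace_diff[OF subspace_tangent] by simp

lemma connection: "affine_connection A D"
  using levi_civita by (simp add: levi_civita_def)

lemma fmult_VF: "f \<in> C \<Longrightarrow> X \<in> VF \<Longrightarrow> fmult f X \<in> VF"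
  unfolding fmult_def by (rule vector_field_scale)

lemma D_VF: "X \<in> VF \<Longrightarrow> Y \<in> VF \<Longrightarrow> D X Y \<in> VF"
  using connection by (simp add: affine_connection_def)

lemma D_add_left: "X \<in> VF \<Longrightarrow> Y \<in> VF \<Longrightarrow> Z \<in> VF \<Longrightarrow> D (X + Y) Z = D X Z + D Y Z"
  using connection by (simp add: affine_connection_def)

lemma D_add_right: "X \<in> VF \<Longrightarrow> Y \<in> VF \<Longrightarrow> Z \<in> VF \<Longrightarrow> D X (Y + Z) = D X Y + D X Z"
  using connection by (simp add: affine_connection_def)

lemma D_fmult_left: "f \<in> C \<Longrightarrow> X \<in> VF \<Longrightarrow> Y \<in> VF \<Longrightarrow> D (fmult f X) Y = fmult f (D X Y)"
  using connection by (simp add: affine_connection_def fmult_def)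

lemma D_fmult_right:
  "f \<in> C \<Longrightarrow> X \<in> VF \<Longrightarrow> Y \<in> VF \<Longrightarrow> D X (fmult f Y) = fmult f (D X Y) + fmult (\<lambda>p. X p f) Y"
  using connection by (simp add: affine_connection_def fmult_def plus_fun_def)

lemma D_diff_left: "X \<in> VF \<Longrightarrow> Y \<in> VF \<Longrightarrow> Z \<in> VF \<Longrightarrow> D (X - Y) Z = D X Z - D Y Z"
  using D_add_left[OF vector_field_diff[of X Y], of Y Z] by (simp add: algebra_simps)

lemma D_diff_right: "X \<in> VF \<Longrightarrow> Y \<in> VF \<Longrightarrow> Z \<in> VF \<Longrightarrow> D X (Y - Z) = D X Y - D X Z"
  using D_add_right[OF _ vector_field_diff[of Y Z], of X Z] by (simp add: algebra_simps)

lemma D_zero_right: "X \<in> VF \<Longrightarrow> D X 0 = 0"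
  using D_diff_right[OF _ vector_field_zero vector_field_zero, of X] by simp

lemma torsion_free: "X \<in> VF \<Longrightarrow> Y \<in> VF \<Longrightarrow> lie_bracket X Y = D X Y - D Y X"
  using levi_civita by (simp add: levi_civita_def)

text \<open>Torsion-freeness writes the bracket as a difference of two values of \<open>D\<close>,
  which are vector fields.\<close>

lemma lie_bracket_VF: "X \<in> VF \<Longrightarrow> Y \<in> VF \<Longrightarrow> lie_bracket X Y \<in> VF"
  by (simp add: torsion_free vector_field_diff D_VF)

lemma compatible:
  "X \<in> VF \<Longrightarrow> Y \<in> VF \<Longrightarrow> Z \<in> VF \<Longrightarrow>
    X p (\<lambda>q. g q (Y q) (Z q)) = g p (D X Y p) (Z p) + g p (Y p) (D X Z p)"
  using levi_civita by (simp add: levi_civita_def)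

lemmas VF_intros = vector_field_add vector_field_diff fmult_VF D_VF lie_bracket_VF
  vector_field_smooth

text \<open>For smooth \<open>f\<close> each double bracket expands into four triple compositions,
  and the twelve terms cancel in pairs. For other \<open>f\<close> all three summands are 0 by the
  convention for tangent vectors.\<close>

lemma jacobi:
  assumes X: "X \<in> VF" and Y: "Y \<in> VF" and Z: "Z \<in> VF"
  shows "lie_bracket X (lie_bracket Y Z) + lie_bracket Y (lie_bracket Z X) +
    lie_bracket Z (lie_bracket X Y) = 0"
proof (intro ext)
  fix p f
  have bracket: "V p (\<lambda>q. lie_bracket W W' q f) = V p (\<lambda>q. W q (\<lambda>q. W' q f)) - V p (\<lambda>q. W' q (\<lambda>q. W q f))"
    if "V \<in> VF" "W \<in> VF" "W' \<in> VF" "f \<in> C" for V W W'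
    unfolding lie_bracket_def
    by (rule tangent_diff[OF vector_field_tangent[OF that(1)]
          vector_field_smooth[OF that(2) vector_field_smooth[OF that(3,4)]]
          vector_field_smooth[OF that(3) vector_field_smooth[OF that(2,4)]]])
  show "(lie_bracket X (lie_bracket Y Z) + lie_bracket Y (lie_bracket Z X) +
    lie_bracket Z (lie_bracket X Y)) p f = 0 p f"
  proof (cases "f \<in> C")
    case True
    have "lie_bracket V (lie_bracket W W') p f = V p (\<lambda>q. W q (\<lambda>q. W' q f)) - V p (\<lambda>q. W' q (\<lambda>q. W q f))
        - (W p (\<lambda>q. W' q (\<lambda>q. V q f)) - W' p (\<lambda>q. W q (\<lambda>q. V q f)))"
      if "V \<in> VF" "W \<in> VF" "W' \<in> VF" for V W W'
      unfolding lie_bracket_def[of V] bracket[OF that True]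
      by (simp add: lie_bracket_def)
    then show ?thesis by (simp add: X Y Z)
  next
    case False
    have "lie_bracket V (lie_bracket W W') p f = 0" if "V \<in> VF" "W \<in> VF" "W' \<in> VF" for V W W'
      using that by (intro tangent_nonsmooth[OF vector_field_tangent False] lie_bracket_VF)
    then show ?thesis by (simp add: X Y Z)
  qed
qed

section \<open>Linearity over functions and symmetries of the curvature operator\<close>

abbreviation "R \<equiv> curvature_operator D"

lemma R_VF: "X \<in> VF \<Longrightarrow> Y \<in> VF \<Longrightarrow> Z \<in> VF \<Longrightarrow> R X Y Z \<in> VF"
  unfolding curvature_operator_def by (intro VF_intros)

lemma R_skew:
  assumes "X \<in> VF" "Y \<in> VF" "Z \<in> VF"
  shows "R Y X Z = - R X Y Z"
proof -
  have "D (lie_bracket Y X) Z = - D (lie_bracket X Y) Z"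
    using assms by (simp add: torsion_free D_diff_left D_VF)
  then show ?thesis by (simp add: curvature_operator_def)
qed

lemma R_add_left:
  assumes "X \<in> VF" "X' \<in> VF" "Y \<in> VF" "Z \<in> VF"
  shows "R (X + X') Y Z = R X Y Z + R X' Y Z"
  using assms
  by (simp add: curvature_operator_def torsion_free D_add_left D_add_right D_diff_left VF_intros algebra_simps)

text \<open>The unwanted term \<open>Y f\<close> times \<open>D X Z\<close>, produced when
  \<open>D Y\<close> meets \<open>fmult f (D X Z)\<close>, is cancelled by the same term from the
  bracket of \<open>fmult f X\<close> and \<open>Y\<close>.\<close>

lemma R_fmult_left:
  assumes "f \<in> C" "X \<in> VF" "Y \<in> VF" "Z \<in> VF"
  shows "R (fmult f X) Y Z = fmult f (R X Y Z)"
proof -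
  have bracket: "lie_bracket (fmult f X) Y = fmult f (lie_bracket X Y) - fmult (\<lambda>p. Y p f) X"
    using assms by (simp add: torsion_free D_fmult_left D_fmult_right VF_intros fun_eq_iff algebra_simps)
  have "D (lie_bracket (fmult f X) Y) Z = fmult f (D (lie_bracket X Y) Z) - fmult (\<lambda>p. Y p f) (D X Z)"
    unfolding bracket using assms by (simp add: D_diff_left D_fmult_left VF_intros)
  then show ?thesis
    unfolding curvature_operator_def
    using assms by (simp add: D_fmult_left D_fmult_right VF_intros fun_eq_iff algebra_simps)
qed

lemma R_add_right:
  assumes "X \<in> VF" "Y \<in> VF" "Z \<in> VF" "Z' \<in> VF"
  shows "R X Y (Z + Z') = R X Y Z + R X Y Z'"
  using assms by (simp add: curvature_operator_def D_add_right VF_intros algebra_simps)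

text \<open>The terms with one derivative of \<open>f\<close> are symmetric in \<open>X\<close> and
  \<open>Y\<close> and cancel; those with two derivatives cancel against the derivative of
  \<open>f\<close> along the bracket.\<close>

lemma R_fmult_right:
  assumes "f \<in> C" "X \<in> VF" "Y \<in> VF" "Z \<in> VF"
  shows "R X Y (fmult f Z) = fmult f (R X Y Z)"
  using assms
  by (simp add: curvature_operator_def D_fmult_right D_add_right VF_intros fun_eq_iff
      lie_bracket_def[of X Y, THEN fun_cong, THEN fun_cong] algebra_simps)

text \<open>Torsion-freeness rewrites each double bracket in terms of \<open>D\<close>; the Jacobi
  identity then becomes the cyclic sum of \<open>R\<close>.\<close>

lemma R_bianchi:
  assumes X: "X \<in> VF" and Y: "Y \<in> VF" and Z: "Z \<in> VF"
  shows "R X Y Z + R Y Z X + R Z X Y = 0"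
proof -
  have *: "lie_bracket U (lie_bracket V W) = D U (D V W) - D U (D W V) - D (lie_bracket V W) U"
    if "U \<in> VF" "V \<in> VF" "W \<in> VF" for U V W
    using that by (simp add: torsion_free[of U "lie_bracket V W"] lie_bracket_VF)
      (simp add: torsion_free D_diff_right VF_intros)
  show ?thesis
    using jacobi[OF X Y Z] unfolding *[OF X Y Z] *[OF Y Z X] *[OF Z X Y]
    by (simp add: curvature_operator_def algebra_simps)
qed

text \<open>Differentiate \<open>g(Z,W)\<close> along \<open>X\<close> and \<open>Y\<close> in both
  orders and along their bracket. The mixed terms, with one derivative on each of \<open>Z\<close>
  and \<open>W\<close>, are symmetric in \<open>X\<close> and \<open>Y\<close> and disappear from
  the commutator.\<close>

lemma R_metric_skew:
  assumes X: "X \<in> VF" and Y: "Y \<in> VF" and Z: "Z \<in> VF" and W: "W \<in> VF"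
  shows "g p (R X Y Z p) (W p) + g p (Z p) (R X Y W p) = 0"
proof -
  note T = vector_field_tangent
  have second: "U p (\<lambda>q. V q (\<lambda>q. g q (Z q) (W q))) =
      g p (D U (D V Z) p) (W p) + g p (D V Z p) (D U W p) + (g p (D U Z p) (D V W p) + g p (Z p) (D U (D V W) p))"
    if "U \<in> VF" "V \<in> VF" for U V
  proof -
    have "U p (\<lambda>q. V q (\<lambda>q. g q (Z q) (W q))) =
        U p (\<lambda>q. g q (D V Z q) (W q) + g q (Z q) (D V W q))"
      by (simp add: compatible that Z W)
    also have "\<dots> = U p (\<lambda>q. g q (D V Z q) (W q)) + U p (\<lambda>q. g q (Z q) (D V W q))"
      by (intro tangent_add[OF T] metric_smooth D_VF that Z W)
    finally show ?thesis by (simp add: compatible that Z W D_VF)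
  qed
  have "lie_bracket X Y p (\<lambda>q. g q (Z q) (W q)) =
      X p (\<lambda>q. Y q (\<lambda>q. g q (Z q) (W q))) - Y p (\<lambda>q. X q (\<lambda>q. g q (Z q) (W q)))"
    by (simp add: lie_bracket_def)
  then have "g p (D (lie_bracket X Y) Z p) (W p) + g p (Z p) (D (lie_bracket X Y) W p) =
      g p (D X (D Y Z) p) (W p) + g p (Z p) (D X (D Y W) p) -
      (g p (D Y (D X Z) p) (W p) + g p (Z p) (D Y (D X W) p))"
    unfolding compatible[OF lie_bracket_VF[OF X Y] Z W] second[OF X Y] second[OF Y X] by simp
  moreover have "g p (R X Y Z p) (W p) = g p (D X (D Y Z) p) (W p) - g p (D Y (D X Z) p) (W p)
      - g p (D (lie_bracket X Y) Z p) (W p)"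
    by (simp add: curvature_operator_def metric_diff_left subspace_diff[OF subspace_tangent] T D_VF lie_bracket_VF assms)
  moreover have "g p (Z p) (R X Y W p) = g p (Z p) (D X (D Y W) p) - g p (Z p) (D Y (D X W) p)
      - g p (Z p) (D (lie_bracket X Y) W p)"
    by (simp add: curvature_operator_def metric_diff_right subspace_diff[OF subspace_tangent] T D_VF lie_bracket_VF assms)
  ultimately show ?thesis by simp
qed

text \<open>The arguments are exchanged one at a time; the middle one is moved to the first place by
  \<open>R_skew\<close>.\<close>

lemma R_tensorial:
  assumes VF: "X \<in> VF" "Y \<in> VF" "Z \<in> VF" "X' \<in> VF" "Y' \<in> VF" "Z' \<in> VF"
    and eq: "X p = X' p" "Y p = Y' p" "Z p = Z' p"
  shows "R X Y Z p = R X' Y' Z' p"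
proof -
  have left: "R U V W p = R U' V W p"
    if "U \<in> VF" "U' \<in> VF" "V \<in> VF" "W \<in> VF" "U p = U' p" for U U' V W
    by (rule tensorial_eq[where G = "\<lambda>U. R U V W p" and p = p])
       (use that in \<open>simp_all add: R_add_left R_fmult_left[unfolded fmult_def]\<close>)
  have "R U V W p = R U V W' p"
    if "U \<in> VF" "V \<in> VF" "W \<in> VF" "W' \<in> VF" "W p = W' p" for U V W W'
    by (rule tensorial_eq[where G = "\<lambda>W. R U V W p" and p = p])
       (use that in \<open>simp_all add: R_add_right R_fmult_right[unfolded fmult_def]\<close>)
  moreover have "R X' Y Z p = R X' Y' Z p"
    using left[of Y Y' X' Z] VF eq R_skew[of X' Y Z] R_skew[of X' Y' Z] by simp
  ultimately show ?thesis using left[of X X' Y Z] VF eq by metis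
qed

abbreviation "ext \<equiv> extension A"

lemma ext_VF: "u \<in> T p \<Longrightarrow> ext p u \<in> VF" and ext_at: "u \<in> T p \<Longrightarrow> ext p u p = u"
  using extension by auto

lemma curvature_tensor_eq:
  assumes "X \<in> VF" "Y \<in> VF" "Z \<in> VF"
  shows "curvature_tensor A D p (X p) (Y p) (Z p) = R X Y Z p"
  unfolding curvature_tensor_def
  by (rule R_tensorial) (use assms in \<open>simp_all add: ext_VF ext_at vector_field_tangent\<close>)

section \<open>The curvature tensor at a point\<close>

context
  fixes p :: 'm
begin

abbreviation "r \<equiv> curvature_tensor A D p"

lemma curvature_tensor_tangent: "x \<in> T p \<Longrightarrow> y \<in> T p \<Longrightarrow> z \<in> T p \<Longrightarrow> r x y z \<in> T p"
  unfolding curvature_tensor_def by (rule vector_field_tangent[OF R_VF]; rule ext_VF)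

lemma curvature_tensor_skew: "x \<in> T p \<Longrightarrow> y \<in> T p \<Longrightarrow> z \<in> T p \<Longrightarrow> r y x z = - r x y z"
  unfolding curvature_tensor_def by (simp add: R_skew[of "ext p x" "ext p y"] ext_VF)

lemma curvature_tensor_bianchi:
  "x \<in> T p \<Longrightarrow> y \<in> T p \<Longrightarrow> z \<in> T p \<Longrightarrow> r x y z + r y z x + r z x y = 0"
  using R_bianchi[of "ext p x" "ext p y" "ext p z", THEN fun_cong, of p]
  by (simp add: curvature_tensor_def ext_VF)

lemma curvature_tensor_metric_skew:
  "x \<in> T p \<Longrightarrow> y \<in> T p \<Longrightarrow> z \<in> T p \<Longrightarrow> w \<in> T p \<Longrightarrow> g p (r x y z) w + g p z (r x y w) = 0"
  using R_metric_skew[of "ext p x" "ext p y" "ext p z" "ext p w" p]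
  by (simp add: curvature_tensor_def ext_VF ext_at)

text \<open>The extension chosen for \<open>u + v\<close> need not be the sum of the chosen
  extensions. Both agree at \<open>p\<close>, however, and \<open>curvature_tensor_eq\<close> allows
  the sum to be used instead; likewise for multiples.\<close>

lemma curvature_tensor_linear_left:
  assumes "y \<in> T p" "z \<in> T p"
  shows "linear_on (T p) (\<lambda>x. r x y z)"
  unfolding linear_on_def
proof (intro conjI ballI allI)
  fix u v assume "u \<in> T p" "v \<in> T p"
  then have "r ((ext p u + ext p v) p) (ext p y p) (ext p z p) = r u y z + r v y z"
    using assms by (subst curvature_tensor_eq) (simp_all add: ext_VF vector_field_add R_add_left curvature_tensor_def)
  then show "r (u + v) y z = r u y z + r v y z"
    using assms \<open>u \<in> T p\<close> \<open>v \<in> T p\<close> by (simp add: ext_at)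
next
  fix a u assume "u \<in> T p"
  then have "r (fmult (\<lambda>_. a) (ext p u) p) (ext p y p) (ext p z p) = a *\<^sub>R r u y z"
    using assms by (subst curvature_tensor_eq)
      (simp_all add: ext_VF fmult_VF smooth_function_const R_fmult_left curvature_tensor_def)
  then show "r (a *\<^sub>R u) y z = a *\<^sub>R r u y z"
    using assms \<open>u \<in> T p\<close> by (simp add: ext_at)
qed

lemma curvature_tensor_linear_right:
  assumes "x \<in> T p" "y \<in> T p"
  shows "linear_on (T p) (r x y)"
  unfolding linear_on_def
proof (intro conjI ballI allI)
  fix u v assume "u \<in> T p" "v \<in> T p"
  then have "r (ext p x p) (ext p y p) ((ext p u + ext p v) p) = r x y u + r x y v"
    using assms by (subst curvature_tensor_eq) (simp_all add: ext_VF vector_field_add R_add_right curvature_tensor_def)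
  then show "r x y (u + v) = r x y u + r x y v"
    using assms \<open>u \<in> T p\<close> \<open>v \<in> T p\<close> by (simp add: ext_at)
next
  fix a u assume "u \<in> T p"
  then have "r (ext p x p) (ext p y p) (fmult (\<lambda>_. a) (ext p u) p) = a *\<^sub>R r x y u"
    using assms by (subst curvature_tensor_eq)
      (simp_all add: ext_VF fmult_VF smooth_function_const R_fmult_right curvature_tensor_def)
  then show "r x y (a *\<^sub>R u) = a *\<^sub>R r x y u"
    using assms \<open>u \<in> T p\<close> by (simp add: ext_at)
qed

end

end

section \<open>Traces\<close>

lemma eq_minus_self: "x = - x \<Longrightarrow> x = 0" for x :: "'a::real_vector"
proof -
  assume "x = - x"
  then have "x + x = 0" by (rule eq_neg_iff_add_eq_0[THEN iffD1])
  then have "2 *\<^sub>R x = 0" by (simp add: scaleR_2)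
  then show ?thesis by simp
qed

lemma linear_on_sum:
  assumes "subspace S" "linear_on S F" "\<And>i. i \<in> I \<Longrightarrow> v i \<in> S"
  shows "F (\<Sum>i\<in>I. v i) = (\<Sum>i\<in>I. F (v i))"
  using assms(3)
proof (induction I rule: infinite_finite_induct)
  case (insert i I)
  then show ?case
    using linear_on_add[OF assms(2), of "v i" "\<Sum>i\<in>I. v i"] subspace_sum[OF assms(1), of I v] by simp
qed (use linear_on_scaleR[OF assms(2) subspace_0[OF assms(1)], of 0] in simp_all)

text \<open>Tangent vectors live in the space of all functionals on functions, so finite dimension
  is a property of the subset \<open>S\<close>, witnessed by a basis.\<close>

locale finite_dim_subspace =
  fixes S :: "'a::real_vector set" and n :: nat
  assumes basis: "\<exists>B. finite B \<and> independent B \<and> span B = S \<and> card B = n"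
begin

lemma subspace: "subspace S"
  using basis subspace_span by blast

lemma add: "u \<in> S \<Longrightarrow> v \<in> S \<Longrightarrow> u + v \<in> S"
  and diff: "u \<in> S \<Longrightarrow> v \<in> S \<Longrightarrow> u - v \<in> S"
  and minus: "u \<in> S \<Longrightarrow> - u \<in> S"
  and scale: "u \<in> S \<Longrightarrow> a *\<^sub>R u \<in> S"
  using subspace by (auto intro: subspace_add subspace_diff subspace_neg subspace_scale)

lemma independent_bound: "independent B \<Longrightarrow> B \<subseteq> S \<Longrightarrow> finite B \<and> card B \<le> n"
  using basis independent_span_bound by metis

lemma generating_bound: "finite B \<Longrightarrow> S \<subseteq> span B \<Longrightarrow> n \<le> card B"
  using basis independent_span_bound span_superset by (metis subset_trans)

text \<open>The choice in \<open>trace_on\<close> depends on \<open>S\<close> only, so a single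
  basis serves all \<open>F\<close> at once; linearity of the trace then comes from linearity of
  \<open>representation\<close>.\<close>

lemma trace_on_basis:
  obtains B where "finite B" "independent B" "span B = S" "card B = n"
    "\<And>F. trace_on S F = (\<Sum>b\<in>B. representation B (F b) b)"
proof
  define B where "B = (SOME B. independent B \<and> span B = S)"
  have "\<exists>B. independent B \<and> span B = S" using basis by blast
  from someI_ex[OF this] have B: "independent B" "span B = S" by (auto simp: B_def)
  show "independent B" "span B = S" by fact+
  have "B \<subseteq> S" using B(2) span_superset by blast
  then show "finite B" using independent_bound B(1) by blast
  then show "card B = n"
    using generating_bound independent_bound B \<open>B \<subseteq> S\<close> by (metis le_antisym order_refl)
  show "trace_on S F = (\<Sum>b\<in>B. representation B (F b) b)" for F
    by (simp add: trace_on_def B_def Let_def)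
qed

lemma trace_on_cong: "(\<And>u. u \<in> S \<Longrightarrow> F u = G u) \<Longrightarrow> trace_on S F = trace_on S G"
proof -
  assume eq: "\<And>u. u \<in> S \<Longrightarrow> F u = G u"
  obtain B where "span B = S" and tr: "\<And>F. trace_on S F = (\<Sum>b\<in>B. representation B (F b) b)"
    by (rule trace_on_basis) blast
  then have "B \<subseteq> S" using span_superset by blast
  then show ?thesis unfolding tr by (intro sum.cong refl) (auto simp: eq)
qed

lemma trace_on_add:
  assumes "\<And>u. u \<in> S \<Longrightarrow> F u \<in> S" "\<And>u. u \<in> S \<Longrightarrow> G u \<in> S"
  shows "trace_on S (\<lambda>u. F u + G u) = trace_on S F + trace_on S G"
proof -
  obtain B where B: "independent B" "span B = S"
    and tr: "\<And>F. trace_on S F = (\<Sum>b\<in>B. representation B (F b) b)"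
    by (rule trace_on_basis) blast
  have "B \<subseteq> S" using B span_superset by blast
  then show ?thesis
    unfolding tr sum.distrib[symmetric]
    by (intro sum.cong refl) (use assms B in \<open>auto simp: representation_add\<close>)
qed

lemma trace_on_scale:
  assumes "\<And>u. u \<in> S \<Longrightarrow> F u \<in> S"
  shows "trace_on S (\<lambda>u. c *\<^sub>R F u) = c * trace_on S F"
proof -
  obtain B where B: "independent B" "span B = S"
    and tr: "\<And>F. trace_on S F = (\<Sum>b\<in>B. representation B (F b) b)"
    by (rule trace_on_basis) blast
  have "B \<subseteq> S" using B span_superset by blast
  then show ?thesis
    unfolding tr sum_distrib_left
    by (intro sum.cong refl) (use assms B in \<open>auto simp: representation_scale\<close>)
qed

lemma trace_on_id: "trace_on S (\<lambda>u. u) = n"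
proof -
  obtain B where B: "independent B" "card B = n"
    and tr: "\<And>F. trace_on S F = (\<Sum>b\<in>B. representation B (F b) b)"
    by (rule trace_on_basis) blast
  show ?thesis unfolding tr using B by (simp add: representation_basis)
qed

text \<open>The diagonal entry at \<open>b\<close> is \<open>\<alpha> b\<close> times the
  \<open>b\<close>-coefficient of \<open>w\<close>; summing over the basis reassembles
  \<open>w\<close> inside \<open>\<alpha>\<close>.\<close>

lemma trace_on_rank_one:
  assumes "linear_on S \<alpha>" "w \<in> S"
  shows "trace_on S (\<lambda>u. \<alpha> u *\<^sub>R w) = \<alpha> w"
proof -
  obtain B where B: "finite B" "independent B" "span B = S"
    and tr: "\<And>F. trace_on S F = (\<Sum>b\<in>B. representation B (F b) b)"
    by (rule trace_on_basis) blast
  have BS: "B \<subseteq> S" using B span_superset by blast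
  have "trace_on S (\<lambda>u. \<alpha> u *\<^sub>R w) = (\<Sum>b\<in>B. representation B w b * \<alpha> b)"
    unfolding tr using assms(2) B by (simp add: representation_scale mult.commute)
  also have "\<dots> = (\<Sum>b\<in>B. \<alpha> (representation B w b *\<^sub>R b))"
    using BS by (intro sum.cong refl) (auto simp: linear_on_scaleR[OF assms(1)])
  also have "\<dots> = \<alpha> (\<Sum>b\<in>B. representation B w b *\<^sub>R b)"
    using BS by (intro linear_on_sum[OF subspace assms(1), symmetric] scale) auto
  also have "(\<Sum>b\<in>B. representation B w b *\<^sub>R b) = w"
    using assms(2) B by (intro real_vector.sum_representation_eq) auto
  finally show ?thesis .
qed

end

section \<open>Algebraic curvature tensors on paracontact spaces\<close>

locale paracontact_space = finite_dim_subspace S 3 for S :: "'a::real_vector set" +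
  fixes g :: "'a \<Rightarrow> 'a \<Rightarrow> real" and \<phi> :: "'a \<Rightarrow> 'a" and \<eta> :: "'a \<Rightarrow> real" and \<xi> :: 'a
  assumes g_linear: "u \<in> S \<Longrightarrow> linear_on S (g u)"
    and g_sym: "u \<in> S \<Longrightarrow> v \<in> S \<Longrightarrow> g u v = g v u"
    and g_nondegenerate: "u \<in> S \<Longrightarrow> (\<And>v. v \<in> S \<Longrightarrow> g u v = 0) \<Longrightarrow> u = 0"
    and \<phi>_linear: "linear_on S \<phi>" and \<phi>_in: "u \<in> S \<Longrightarrow> \<phi> u \<in> S"
    and \<eta>_linear: "linear_on S \<eta>" and \<xi>_in: "\<xi> \<in> S"
    and \<phi>_\<xi>: "\<phi> \<xi> = 0" and \<eta>_\<xi>: "\<eta> \<xi> = 1" and \<eta>_\<phi>: "u \<in> S \<Longrightarrow> \<eta> (\<phi> u) = 0"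
    and \<phi>_\<phi>: "u \<in> S \<Longrightarrow> \<phi> (\<phi> u) = u - \<eta> u *\<^sub>R \<xi>"
    and paracomplex: "almost_paracomplex_structure {u\<in>S. \<eta> u = 0} \<phi>"
    and g_\<phi>_\<phi>: "u \<in> S \<Longrightarrow> v \<in> S \<Longrightarrow> g (\<phi> u) (\<phi> v) = - g u v + \<eta> u * \<eta> v"
begin

lemma g_add [simp]: "u \<in> S \<Longrightarrow> v \<in> S \<Longrightarrow> w \<in> S \<Longrightarrow> g u (v + w) = g u v + g u w"
  by (rule linear_on_add[OF g_linear])

lemma g_scale [simp]: "u \<in> S \<Longrightarrow> v \<in> S \<Longrightarrow> g u (a *\<^sub>R v) = a * g u v"
  using linear_on_scaleR[OF g_linear] by simp

lemma g_minus [simp]: "u \<in> S \<Longrightarrow> v \<in> S \<Longrightarrow> g u (- v) = - g u v"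
  using g_scale[of u v "-1"] by simp

lemma g_diff [simp]: "u \<in> S \<Longrightarrow> v \<in> S \<Longrightarrow> w \<in> S \<Longrightarrow> g u (v - w) = g u v - g u w"
  using g_add[of u v "- w"] minus by simp

lemma g_minus_left [simp]: "u \<in> S \<Longrightarrow> v \<in> S \<Longrightarrow> g (- u) v = - g u v"
  using g_sym[of _ v] minus by simp

lemma g_zero [simp]: "u \<in> S \<Longrightarrow> g u 0 = 0"
  using g_diff[of u 0 0] subspace_0[OF subspace] by simp

text \<open>Compatibility of \<open>g\<close> and \<open>\<phi>\<close> at \<open>v = \<xi>\<close>,
  where the left side is \<open>g (\<phi> u) 0\<close>.\<close>

lemma g_\<xi>: "u \<in> S \<Longrightarrow> g u \<xi> = \<eta> u"
  using g_\<phi>_\<phi>[OF _ \<xi>_in, of u] \<phi>_\<xi> \<eta>_\<xi> \<phi>_in by simp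

lemma \<eta>_add [simp]: "u \<in> S \<Longrightarrow> v \<in> S \<Longrightarrow> \<eta> (u + v) = \<eta> u + \<eta> v"
  by (rule linear_on_add[OF \<eta>_linear])

lemma \<eta>_scale [simp]: "u \<in> S \<Longrightarrow> \<eta> (a *\<^sub>R u) = a * \<eta> u"
  using linear_on_scaleR[OF \<eta>_linear] by simp

lemma \<phi>_scale: "u \<in> S \<Longrightarrow> \<phi> (a *\<^sub>R u) = a *\<^sub>R \<phi> u"
  by (rule linear_on_scaleR[OF \<phi>_linear])

lemma \<phi>_add: "u \<in> S \<Longrightarrow> v \<in> S \<Longrightarrow> \<phi> (u + v) = \<phi> u + \<phi> v"
  by (rule linear_on_add[OF \<phi>_linear])

text \<open>The nested comprehension reproduces the sets in
  \<open>almost_paracomplex_structure\<close> for the plane \<open>ker \<eta>\<close>, with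
  \<open>a\<close> equal to 1 or -1.\<close>

definition "eigen a = {u\<in>{u\<in>S. \<eta> u = 0}. \<phi> u = a *\<^sub>R u}"

lemma subspace_eigen: "subspace (eigen a)"
  unfolding subspace_def eigen_def
  using \<phi>_scale[OF \<xi>_in, of 0] \<eta>_scale[OF \<xi>_in, of 0]
  by (auto simp: subspace_0[OF subspace] add scale \<phi>_add \<phi>_scale algebra_simps)

text \<open>A count of dimensions: bases \<open>P\<close> and \<open>M\<close> of the two
  eigenspaces have the same size \<open>k\<close>. Their union is independent, whence
  \<open>2 * k \<le> 3\<close>; together with \<open>\<xi>\<close> it spans \<open>S\<close>, whence
  \<open>3 \<le> 2 * k + 1\<close>. So \<open>k = 1\<close>.\<close>

lemma eigen_basis:
  obtains e1 e2 where "e1 \<in> eigen 1" "e2 \<in> eigen (-1)"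
    "\<And>u. u \<in> S \<Longrightarrow> \<exists>a b. u = a *\<^sub>R e1 + b *\<^sub>R e2 + \<eta> u *\<^sub>R \<xi>"
proof -
  have dims: "dim (eigen 1) = dim (eigen (-1))"
    using paracomplex by (simp add: almost_paracomplex_structure_def eigen_def)
  obtain P where P: "P \<subseteq> eigen 1" "independent P" "eigen 1 \<subseteq> span P" "card P = dim (eigen 1)"
    by (rule basis_exists)
  obtain M where M: "M \<subseteq> eigen (-1)" "independent M" "eigen (-1) \<subseteq> span M" "card M = dim (eigen (-1))"
    by (rule basis_exists)
  have eigen_S: "eigen a \<subseteq> S" for a by (auto simp: eigen_def)
  have fin: "finite P" "finite M"
    using independent_bound[OF P(2)] independent_bound[OF M(2)] P(1) M(1) eigen_S by blast+
  have eigen_Int: "u = 0" if "u \<in> eigen 1" "u \<in> eigen (-1)" for u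
  proof -
    have "u = - u" using that by (simp add: eigen_def)
    then show ?thesis by (rule eq_minus_self)
  qed
  have disj: "P \<inter> M = {}"
    using eigen_Int P(1,2) M(1) real_vector.dependent_zero[of P] by blast
  have "independent (P \<union> M)"
  proof
    assume "dependent (P \<union> M)"
    then obtain a x where zero: "(\<Sum>x\<in>P \<union> M. a x *\<^sub>R x) = 0" and x: "x \<in> P \<union> M" "a x \<noteq> 0"
      using real_vector.dependent_finite[of "P \<union> M"] fin by auto
    let ?p = "\<Sum>x\<in>P. a x *\<^sub>R x" and ?m = "\<Sum>x\<in>M. a x *\<^sub>R x"
    have p: "?p \<in> eigen 1" and m: "?m \<in> eigen (-1)"
      using P(1) M(1) subspace_eigen by (auto intro!: subspace_sum subspace_scale)
    have "?p + ?m = 0" using zero fin disj by (simp add: sum.union_disjoint)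
    then have "?p = - ?m" by (rule eq_neg_iff_add_eq_0[THEN iffD2])
    then have "?p \<in> eigen (-1)" using subspace_neg[OF subspace_eigen m] by simp
    with p have "?p = 0" by (rule eigen_Int)
    with \<open>?p = - ?m\<close> have "?m = 0" by simp
    have "a y = 0" if "y \<in> P" for y
      using real_vector.independentD[OF P(2) fin(1) order_refl \<open>?p = 0\<close> that] .
    moreover have "a y = 0" if "y \<in> M" for y
      using real_vector.independentD[OF M(2) fin(2) order_refl \<open>?m = 0\<close> that] .
    ultimately show False using x by blast
  qed
  then have "card (P \<union> M) \<le> 3"
    using independent_bound[of "P \<union> M"] P(1) M(1) eigen_S by blast
  then have "2 * card P \<le> 3"
    using disj fin P(4) M(4) dims by (simp add: card_Un_disjoint)
  \<comment> \<open>Removing the \<open>\<xi>\<close>-component leaves a vector \<open>w\<close> of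
    \<open>ker \<eta>\<close>, on which \<open>\<phi>\<close> is an involution; half the sum and
    half the difference of \<open>w\<close> and \<open>\<phi> w\<close> are its
    eigencomponents.\<close>
  have split: "\<exists>p\<in>eigen 1. \<exists>m\<in>eigen (-1). u = p + m + \<eta> u *\<^sub>R \<xi>" if u: "u \<in> S" for u
  proof (intro bexI)
    let ?w = "u + (- \<eta> u) *\<^sub>R \<xi>"
    have w: "?w \<in> S" using u \<xi>_in add scale by blast
    have \<eta>w: "\<eta> ?w = 0" using u \<xi>_in \<eta>_\<xi> scale by (simp del: scaleR_minus_left)
    have \<phi>w: "\<phi> (\<phi> ?w) = ?w" using \<phi>_\<phi>[OF w] \<eta>w by simp
    note in_S = w \<phi>_in[OF w] \<phi>_in[OF \<phi>_in[OF w]]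
    show "(1/2) *\<^sub>R ?w + (1/2) *\<^sub>R \<phi> ?w \<in> eigen 1"
      using in_S \<eta>w \<eta>_\<phi>[OF w] \<phi>w unfolding eigen_def
      by (simp add: add scale \<phi>_add \<phi>_scale del: scaleR_minus_left)
    show "(1/2) *\<^sub>R ?w + (-1/2) *\<^sub>R \<phi> ?w \<in> eigen (-1)"
      using in_S \<eta>w \<eta>_\<phi>[OF w] \<phi>w unfolding eigen_def
      by (simp add: add scale \<phi>_add \<phi>_scale del: scaleR_minus_left) (simp add: algebra_simps)
    have "(1/2) *\<^sub>R a + (1/2) *\<^sub>R b + ((1/2) *\<^sub>R a + (-1/2) *\<^sub>R b) = a" for a b :: 'a
    proof -
      have "(1/2) *\<^sub>R a + (1/2) *\<^sub>R b + ((1/2) *\<^sub>R a + (-1/2) *\<^sub>R b) = (1/2) *\<^sub>R a + (1/2) *\<^sub>R a"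
        by (simp add: algebra_simps)
      also have "\<dots> = (1/2 + 1/2) *\<^sub>R a" by (simp only: scaleR_left_distrib)
      finally show ?thesis by simp
    qed
    from this[of ?w "\<phi> ?w"]
    show "u = (1/2) *\<^sub>R ?w + (1/2) *\<^sub>R \<phi> ?w + ((1/2) *\<^sub>R ?w + (-1/2) *\<^sub>R \<phi> ?w) + \<eta> u *\<^sub>R \<xi>"
      by (simp only:) simp
  qed
  have "S \<subseteq> span (insert \<xi> (P \<union> M))"
  proof
    fix u assume "u \<in> S"
    from split[OF this] obtain p m where "p \<in> eigen 1" "m \<in> eigen (-1)" "u = p + m + \<eta> u *\<^sub>R \<xi>" by blast
    moreover have "span P \<subseteq> span (insert \<xi> (P \<union> M))" "span M \<subseteq> span (insert \<xi> (P \<union> M))"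
      by (intro span_mono; blast)+
    ultimately show "u \<in> span (insert \<xi> (P \<union> M))"
      using P(3) M(3) by (metis (no_types, lifting) insertI1 span_add span_base span_scale subsetD)
  qed
  then have "3 \<le> card (insert \<xi> (P \<union> M))" using fin by (intro generating_bound) auto
  also have "\<dots> \<le> Suc (card (P \<union> M))" by (rule card_insert_le_m1) auto
  finally have "card P = 1"
    using \<open>2 * card P \<le> 3\<close> disj fin P(4) M(4) dims by (simp add: card_Un_disjoint)
  then have "card M = 1" using P(4) M(4) dims by simp
  from \<open>card P = 1\<close> \<open>card M = 1\<close> obtain e1 e2 where e: "P = {e1}" "M = {e2}"
    by (auto simp: card_1_singleton_iff)
  show thesis
  proof
    show "e1 \<in> eigen 1" "e2 \<in> eigen (-1)" using P(1) M(1) e by auto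
    show "\<exists>a b. u = a *\<^sub>R e1 + b *\<^sub>R e2 + \<eta> u *\<^sub>R \<xi>" if "u \<in> S" for u
    proof -
      from split[OF that] obtain p m where pm: "p \<in> eigen 1" "m \<in> eigen (-1)" "u = p + m + \<eta> u *\<^sub>R \<xi>" by blast
      then have "p \<in> span {e1}" "m \<in> span {e2}" using P(3) M(3) e by auto
      then obtain a b where "p = a *\<^sub>R e1" "m = b *\<^sub>R e2" by (auto simp: span_singleton)
      with pm(3) show ?thesis by metis
    qed
  qed
qed

text \<open>On \<open>ker \<eta>\<close> the map \<open>\<phi>\<close> reverses the sign of
  \<open>g\<close>, so its eigenvectors for 1 and -1 are null. If their pairing \<open>h\<close>
  were 0 as well, nondegeneracy would make both vectors 0 and \<open>\<xi>\<close> alone would span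
  \<open>S\<close>. Since \<open>e1\<close> and \<open>e2\<close> are null, the coefficient of each
  is read off by pairing with the other.\<close>

lemma null_basis:
  obtains e1 e2 h where "e1 \<in> S" "e2 \<in> S" "\<eta> e1 = 0" "\<eta> e2 = 0" "g e1 e1 = 0" "g e2 e2 = 0"
    "g e1 e2 = h" "h \<noteq> 0"
    "\<And>u. u \<in> S \<Longrightarrow> u = (g u e2 / h) *\<^sub>R e1 + (g u e1 / h) *\<^sub>R e2 + \<eta> u *\<^sub>R \<xi>"
proof -
  obtain e1 e2 where e: "e1 \<in> eigen 1" "e2 \<in> eigen (-1)"
    and decomp: "\<And>u. u \<in> S \<Longrightarrow> \<exists>a b. u = a *\<^sub>R e1 + b *\<^sub>R e2 + \<eta> u *\<^sub>R \<xi>"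
    by (rule eigen_basis) blast
  then have S: "e1 \<in> S" "e2 \<in> S" and \<eta>: "\<eta> e1 = 0" "\<eta> e2 = 0" and \<phi>: "\<phi> e1 = e1" "\<phi> e2 = - e2"
    by (auto simp: eigen_def)
  have "g e1 e1 = - g e1 e1" using g_\<phi>_\<phi>[OF S(1) S(1)] \<eta> \<phi> by simp
  then have g11: "g e1 e1 = 0" by simp
  have "g e2 e2 = - g e2 e2" using g_\<phi>_\<phi>[OF S(2) S(2)] \<eta> \<phi> S minus by simp
  then have g22: "g e2 e2 = 0" by simp
  have formula: "g u e1 = b * g e1 e2 \<and> g u e2 = a * g e1 e2"
    if "u = a *\<^sub>R e1 + b *\<^sub>R e2 + c *\<^sub>R \<xi>" for u a b c
  proof -
    have u: "u \<in> S" using that S \<xi>_in by (simp add: add scale)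
    have "g e u = a * g e e1 + b * g e e2 + c * \<eta> e" if e: "e \<in> S" for e
      unfolding \<open>u = _\<close> using S \<xi>_in e by (simp add: add scale g_\<xi>)
    then show ?thesis using S g11 g22 \<eta> g_sym[OF S] g_sym[OF u] by simp
  qed
  have "g e1 e2 \<noteq> 0"
  proof
    assume h: "g e1 e2 = 0"
    have zero: "e = 0" if e: "e \<in> {e1, e2}" for e
    proof (rule g_nondegenerate)
      show "e \<in> S" using e S by auto
      fix v assume v: "v \<in> S"
      obtain a b where "v = a *\<^sub>R e1 + b *\<^sub>R e2 + \<eta> v *\<^sub>R \<xi>" using decomp[OF v] by blast
      from formula[OF this] h show "g e v = 0" using e S v g_sym[of v e] by auto
    qed
    have "S \<subseteq> span {\<xi>}"
    proof
      fix u assume "u \<in> S"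
      then obtain a b where "u = a *\<^sub>R e1 + b *\<^sub>R e2 + \<eta> u *\<^sub>R \<xi>" using decomp by blast
      also have "\<dots> = \<eta> u *\<^sub>R \<xi>" using zero[of e1] zero[of e2] by simp
      also have "\<dots> \<in> span {\<xi>}" by (intro span_scale span_base) simp
      finally show "u \<in> span {\<xi>}" .
    qed
    then have "3 \<le> card {\<xi>}" by (intro generating_bound) auto
    then show False by simp
  qed
  moreover have "u = (g u e2 / g e1 e2) *\<^sub>R e1 + (g u e1 / g e1 e2) *\<^sub>R e2 + \<eta> u *\<^sub>R \<xi>" if "u \<in> S" for u
  proof -
    from decomp[OF that] obtain a b where ab: "u = a *\<^sub>R e1 + b *\<^sub>R e2 + \<eta> u *\<^sub>R \<xi>" by blast
    from formula[OF this] \<open>g e1 e2 \<noteq> 0\<close> have "g u e2 / g e1 e2 = a" "g u e1 / g e1 e2 = b" by simp_all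
    then show ?thesis using ab by simp
  qed
  ultimately show thesis using that S \<eta> g11 g22 by blast
qed

end

locale paracontact_curvature = paracontact_space +
  fixes r :: "'a \<Rightarrow> 'a \<Rightarrow> 'a \<Rightarrow> 'a"
  assumes r_in: "x \<in> S \<Longrightarrow> y \<in> S \<Longrightarrow> z \<in> S \<Longrightarrow> r x y z \<in> S"
    and r_linear_left: "y \<in> S \<Longrightarrow> z \<in> S \<Longrightarrow> linear_on S (\<lambda>x. r x y z)"
    and r_linear_right: "x \<in> S \<Longrightarrow> y \<in> S \<Longrightarrow> linear_on S (r x y)"
    and r_skew: "x \<in> S \<Longrightarrow> y \<in> S \<Longrightarrow> z \<in> S \<Longrightarrow> r y x z = - r x y z"
    and r_bianchi: "x \<in> S \<Longrightarrow> y \<in> S \<Longrightarrow> z \<in> S \<Longrightarrow> r x y z + r y z x + r z x y = 0"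
    and r_metric_skew: "x \<in> S \<Longrightarrow> y \<in> S \<Longrightarrow> z \<in> S \<Longrightarrow> w \<in> S \<Longrightarrow> g (r x y z) w + g z (r x y w) = 0"
begin

lemma flat_if_\<xi>_and_trace:
  assumes r_\<xi>: "\<And>x y. x \<in> S \<Longrightarrow> y \<in> S \<Longrightarrow> r x y \<xi> = 0"
    and tr: "\<And>y z. y \<in> S \<Longrightarrow> z \<in> S \<Longrightarrow> trace_on S (\<lambda>x. r x y z) = 0"
    and xyz: "x \<in> S" "y \<in> S" "z \<in> S"
  shows "r x y z = 0"
proof -
  have add_left: "r (u + v) b c = r u b c + r v b c" if "u \<in> S" "v \<in> S" "b \<in> S" "c \<in> S" for u v b c
    using linear_on_add[OF r_linear_left] that by simp
  have scale_left: "r (a *\<^sub>R u) b c = a *\<^sub>R r u b c" if "u \<in> S" "b \<in> S" "c \<in> S" for a u b c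
    using linear_on_scaleR[OF r_linear_left] that by simp
  have add_mid: "r b (u + v) c = r b u c + r b v c" if "u \<in> S" "v \<in> S" "b \<in> S" "c \<in> S" for u v b c
    using that add_left[OF that] r_skew[of _ b c] by (simp add: add)
  have scale_mid: "r b (a *\<^sub>R u) c = a *\<^sub>R r b u c" if "u \<in> S" "b \<in> S" "c \<in> S" for a u b c
    using that scale_left[OF that] r_skew[of _ b c] by (simp add: scale)
  have add_right: "r b c (u + v) = r b c u + r b c v" if "u \<in> S" "v \<in> S" "b \<in> S" "c \<in> S" for u v b c
    using linear_on_add[OF r_linear_right] that by simp
  have scale_right: "r b c (a *\<^sub>R u) = a *\<^sub>R r b c u" if "u \<in> S" "b \<in> S" "c \<in> S" for a u b c
    using linear_on_scaleR[OF r_linear_right] that by simp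
  have r_self: "r u u v = 0" if "u \<in> S" "v \<in> S" for u v
  proof -
    have "r u u v = - r u u v" using r_skew that by blast
    then show ?thesis by (rule eq_minus_self)
  qed
  \<comment> \<open>The trilinear form \<open>g (r u \<xi> v) w\<close> is symmetric in
    \<open>u, v\<close> by Bianchi and skew in \<open>v, w\<close>. Three symmetric and three skew
    exchanges, alternating, return to the start with an odd number of signs.\<close>
  have r_\<xi>_mid: "r u \<xi> v = 0" if u: "u \<in> S" and v: "v \<in> S" for u v
  proof (rule g_nondegenerate)
    show "r u \<xi> v \<in> S" using r_in u v \<xi>_in by blast
    have swap: "r a \<xi> b = r b \<xi> a" if "a \<in> S" "b \<in> S" for a b
      using r_bianchi[OF that(1) \<xi>_in that(2)] r_\<xi>[OF that(2,1)] r_skew[OF that(2) \<xi>_in that(1)] by simp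
    have skew: "g (r a \<xi> b) c = - g (r a \<xi> c) b" if "a \<in> S" "b \<in> S" "c \<in> S" for a b c
      using r_metric_skew[OF that(1) \<xi>_in that(2,3)] g_sym[of b "r a \<xi> c"] r_in \<xi>_in that by simp
    fix w assume w: "w \<in> S"
    have "g (r u \<xi> v) w = - g (r u \<xi> v) w"
      using swap[OF u v] skew[OF v u w] swap[OF v w] skew[OF w v u] swap[OF w u] skew[OF u w v]
      by simp
    then show "g (r u \<xi> v) w = 0" by simp
  qed
  have r_\<xi>_left: "r \<xi> u v = 0" if "u \<in> S" "v \<in> S" for u v
    using r_skew[OF that(1) \<xi>_in that(2)] r_\<xi>_mid[OF that] by simp
  obtain e1 e2 h where e: "e1 \<in> S" "e2 \<in> S" "\<eta> e1 = 0" "\<eta> e2 = 0" "g e1 e1 = 0" "g e2 e2 = 0"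
      "g e1 e2 = h" "h \<noteq> 0"
    and decomp: "\<And>u. u \<in> S \<Longrightarrow> u = (g u e2 / h) *\<^sub>R e1 + (g u e1 / h) *\<^sub>R e2 + \<eta> u *\<^sub>R \<xi>"
    by (rule null_basis) blast
  have g_self: "g (r u v w) w = 0" if "u \<in> S" "v \<in> S" "w \<in> S" for u v w
    using r_metric_skew[OF that that(3)] g_sym[of w "r u v w"] r_in that by simp
  have \<eta>_r: "\<eta> (r u v w) = 0" if "u \<in> S" "v \<in> S" "w \<in> S" for u v w
    using r_metric_skew[OF that \<xi>_in] g_\<xi>[of "r u v w"] r_\<xi> r_in that by simp
  \<comment> \<open>\<open>r e1 e2 e1\<close> is orthogonal to \<open>e1\<close> and to
    \<open>\<xi>\<close>, and \<open>r e1 e2 e2\<close> to \<open>e2\<close> and to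
    \<open>\<xi>\<close>; by metric skew-symmetry this one number determines both.\<close>
  define K where "K = g (r e1 e2 e1) e2"
  have r_e1: "r e1 e2 e1 = (K / h) *\<^sub>R e1"
    using decomp[of "r e1 e2 e1"] g_self[OF e(1,2,1)] \<eta>_r[OF e(1,2,1)] r_in e by (simp add: K_def)
  have "g (r e1 e2 e2) e1 = - K"
    using r_metric_skew[OF e(1,2) e(1,2)] g_sym[of e1 "r e1 e2 e2"] r_in e by (simp add: K_def)
  then have r_e2: "r e1 e2 e2 = - (K / h) *\<^sub>R e2"
    using decomp[of "r e1 e2 e2"] g_self[OF e(1,2,2)] \<eta>_r[OF e(1,2,2)] r_in e by simp
  \<comment> \<open>Only the \<open>e1\<close>-component \<open>g u e2 / h\<close> of
    \<open>u\<close> survives in \<open>r u e2 e1\<close>, so the endomorphism has rank one, with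
    trace \<open>K / h\<close>.\<close>
  have "trace_on S (\<lambda>u. r u e2 e1) = trace_on S (\<lambda>u. g e2 u *\<^sub>R ((1 / h) *\<^sub>R r e1 e2 e1))"
  proof (rule trace_on_cong)
    fix u assume u: "u \<in> S"
    have "r u e2 e1 = r ((g u e2 / h) *\<^sub>R e1 + (g u e1 / h) *\<^sub>R e2 + \<eta> u *\<^sub>R \<xi>) e2 e1"
      using decomp[OF u] by simp
    also have "\<dots> = (g u e2 / h) *\<^sub>R r e1 e2 e1"
      using e \<xi>_in by (simp add: add scale add_left scale_left r_self r_\<xi>_left)
    finally show "r u e2 e1 = g e2 u *\<^sub>R ((1 / h) *\<^sub>R r e1 e2 e1)"
      using g_sym[OF u e(2)] by simp
  qed
  also have "\<dots> = g e2 ((1 / h) *\<^sub>R r e1 e2 e1)"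
    by (rule trace_on_rank_one[OF g_linear]) (use e r_in scale in auto)
  also have "\<dots> = K / h"
    using e r_in g_sym[of e2 "r e1 e2 e1"] by (simp add: K_def)
  finally have "K = 0" using tr[OF e(2,1)] e(8) by simp
  with r_e1 r_e2 have r0: "r e1 e2 e1 = 0" "r e1 e2 e2 = 0" by simp_all
  have r0': "r e1 e2 v = 0" if v: "v \<in> S" for v
  proof -
    have "r e1 e2 v = r e1 e2 ((g v e2 / h) *\<^sub>R e1 + (g v e1 / h) *\<^sub>R e2 + \<eta> v *\<^sub>R \<xi>)"
      using decomp[OF v] by simp
    then show ?thesis using e \<xi>_in by (simp add: add scale add_right scale_right r0 r_\<xi>)
  qed
  have r1: "r e1 u v = 0" if u: "u \<in> S" and v: "v \<in> S" for u v
  proof -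
    have "r e1 u v = r e1 ((g u e2 / h) *\<^sub>R e1 + (g u e1 / h) *\<^sub>R e2 + \<eta> u *\<^sub>R \<xi>) v"
      using decomp[OF u] by simp
    then show ?thesis using e \<xi>_in v by (simp add: add scale add_mid scale_mid r0' r_self r_\<xi>_mid)
  qed
  have r2: "r e2 u v = 0" if u: "u \<in> S" and v: "v \<in> S" for u v
  proof -
    have "r e2 u v = r e2 ((g u e2 / h) *\<^sub>R e1 + (g u e1 / h) *\<^sub>R e2 + \<eta> u *\<^sub>R \<xi>) v"
      using decomp[OF u] by simp
    moreover have "r e2 e1 v = 0" using r_skew[OF e(1,2) v] r0'[OF v] by simp
    ultimately show ?thesis using e \<xi>_in v by (simp add: add scale add_mid scale_mid r_self r_\<xi>_mid)
  qed
  have "r x y z = r ((g x e2 / h) *\<^sub>R e1 + (g x e1 / h) *\<^sub>R e2 + \<eta> x *\<^sub>R \<xi>) y z"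
    using decomp[OF xyz(1)] by simp
  then show ?thesis using e \<xi>_in xyz by (simp add: add scale add_left scale_left r1 r2 r_\<xi>_left)
qed

lemma constant_curvature_if_ricci_semisymmetric:
  assumes r_\<xi>: "\<And>x y. x \<in> S \<Longrightarrow> y \<in> S \<Longrightarrow> r x y \<xi> = \<eta> x *\<^sub>R y - \<eta> y *\<^sub>R x"
    and semi: "\<And>x y u v. x \<in> S \<Longrightarrow> y \<in> S \<Longrightarrow> u \<in> S \<Longrightarrow> v \<in> S \<Longrightarrow>
      trace_on S (\<lambda>w. r w (r x y u) v) + trace_on S (\<lambda>w. r w u (r x y v)) = 0"
    and xyz: "x \<in> S" "y \<in> S" "z \<in> S"
  shows "r x y z = - (g y z *\<^sub>R x - g x z *\<^sub>R y)"
proof -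
  define ric where "ric y z = trace_on S (\<lambda>w. r w y z)" for y z
  have ric_add: "ric y (u + v) = ric y u + ric y v" if "y \<in> S" "u \<in> S" "v \<in> S" for y u v
  proof -
    have "ric y (u + v) = trace_on S (\<lambda>w. r w y u + r w y v)"
      unfolding ric_def by (rule trace_on_cong) (use linear_on_add[OF r_linear_right] that in auto)
    also have "\<dots> = ric y u + ric y v"
      unfolding ric_def by (rule trace_on_add) (use r_in that in auto)
    finally show ?thesis .
  qed
  have ric_scale: "ric y (a *\<^sub>R u) = a * ric y u" if "y \<in> S" "u \<in> S" for y u a
  proof -
    have "ric y (a *\<^sub>R u) = trace_on S (\<lambda>w. a *\<^sub>R r w y u)"
      unfolding ric_def by (rule trace_on_cong) (use linear_on_scaleR[OF r_linear_right] that in auto)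
    also have "\<dots> = a * ric y u"
      unfolding ric_def by (rule trace_on_scale) (use r_in that in auto)
    finally show ?thesis .
  qed
  \<comment> \<open>The factor -2 is 1 - 3: the rank-one part contributes \<open>\<eta> y\<close>,
    the multiple of the identity \<open>- 3 * \<eta> y\<close>.\<close>
  have ric_\<xi>: "ric y \<xi> = - 2 * \<eta> y" if y: "y \<in> S" for y
  proof -
    have "ric y \<xi> = trace_on S (\<lambda>w. \<eta> w *\<^sub>R y + (- \<eta> y) *\<^sub>R w)"
      unfolding ric_def by (rule trace_on_cong) (simp add: r_\<xi> y)
    also have "\<dots> = trace_on S (\<lambda>w. \<eta> w *\<^sub>R y) + trace_on S (\<lambda>w. (- \<eta> y) *\<^sub>R w)"
      by (rule trace_on_add) (use y scale minus in auto)
    also have "trace_on S (\<lambda>w. \<eta> w *\<^sub>R y) = \<eta> y" by (rule trace_on_rank_one[OF \<eta>_linear y])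
    also have "trace_on S (\<lambda>w. (- \<eta> y) *\<^sub>R w) = (- \<eta> y) * 3"
      by (subst trace_on_scale) (simp_all add: trace_on_id)
    finally show ?thesis by simp
  qed
  \<comment> \<open>Semisymmetry for the vectors \<open>x, \<xi>, u, \<xi>\<close>. The first
    summand is known from \<open>ric_\<xi>\<close>, with \<open>\<eta> (r x \<xi> u)\<close> found
    by metric skew-symmetry; the second contains \<open>- ric u x\<close>. The products of values of
    \<open>\<eta>\<close> cancel.\<close>
  have ric: "ric u x = - 2 * g u x" if u: "u \<in> S" and x: "x \<in> S" for u x
  proof -
    have r_xi: "r x \<xi> \<xi> = \<eta> x *\<^sub>R \<xi> + (- 1) *\<^sub>R x"
      using r_\<xi>[OF x \<xi>_in] \<eta>_\<xi> by simp
    have "\<eta> (r x \<xi> u) = g (r x \<xi> u) \<xi>" using g_\<xi> r_in x u \<xi>_in by simp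
    also have "\<dots> = - g u (r x \<xi> \<xi>)" using r_metric_skew[OF x \<xi>_in u \<xi>_in] by simp
    also have "\<dots> = g u x - \<eta> x * \<eta> u"
      unfolding r_xi using u x \<xi>_in by (simp add: scale minus g_\<xi> del: scaleR_minus_left)
    finally have "ric (r x \<xi> u) \<xi> = - 2 * (g u x - \<eta> x * \<eta> u)"
      using ric_\<xi> r_in x u \<xi>_in by simp
    moreover have "ric u (r x \<xi> \<xi>) = \<eta> x * (- 2 * \<eta> u) - ric u x"
      unfolding r_xi ric_add[OF u scale[OF \<xi>_in] scale[OF x]] ric_scale[OF u x] ric_scale[OF u \<xi>_in]
      by (simp add: ric_\<xi> u)
    moreover have "ric (r x \<xi> u) \<xi> + ric u (r x \<xi> \<xi>) = 0"
      unfolding ric_def by (rule semi[OF x \<xi>_in u \<xi>_in])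
    ultimately show ?thesis by (simp add: algebra_simps)
  qed
  define q where "q x y z = r x y z + g y z *\<^sub>R x - g x z *\<^sub>R y" for x y z
  interpret q: paracontact_curvature S g \<phi> \<eta> \<xi> q
  proof
    fix x y z assume xyz: "x \<in> S" "y \<in> S" "z \<in> S"
    show "q x y z \<in> S" unfolding q_def using xyz r_in add diff scale by simp
    show "q y x z = - q x y z" unfolding q_def using r_skew[OF xyz] by simp
    show "q x y z + q y z x + q z x y = 0"
      unfolding q_def using r_bianchi[OF xyz] g_sym[OF xyz(1,2)] g_sym[OF xyz(2,3)] g_sym[OF xyz(1,3)]
      by (simp add: algebra_simps)
    fix w assume w: "w \<in> S"
    have "g (q x y z) w = g (r x y z) w + g y z * g x w - g x z * g y w"
    proof -
      have "g w (q x y z) = g w (r x y z) + g y z * g w x - g x z * g w y"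
        unfolding q_def using xyz w r_in by (simp add: add scale)
      then show ?thesis
        using g_sym[OF w] \<open>q x y z \<in> S\<close> r_in xyz by simp
    qed
    moreover have "g z (q x y w) = g z (r x y w) + g y w * g z x - g x w * g z y"
      unfolding q_def using xyz w r_in by (simp add: add scale)
    ultimately show "g (q x y z) w + g z (q x y w) = 0"
      using r_metric_skew[OF xyz w] g_sym[OF xyz(1,3)] g_sym[OF xyz(2,3)] by (simp add: algebra_simps)
  next
    fix y z assume yz: "y \<in> S" "z \<in> S"
    show "linear_on S (\<lambda>x. q x y z)"
      unfolding linear_on_def q_def
      using linear_on_add[OF r_linear_left[OF yz]] linear_on_scaleR[OF r_linear_left[OF yz]] yz
      by (simp add: g_sym[of _ z] add scale algebra_simps)
  next
    fix x y assume xy: "x \<in> S" "y \<in> S"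
    show "linear_on S (q x y)"
      unfolding linear_on_def q_def
      using linear_on_add[OF r_linear_right[OF xy]] linear_on_scaleR[OF r_linear_right[OF xy]] xy
      by (simp add: algebra_simps)
  qed
  have "q x y z = 0"
  proof (rule q.flat_if_\<xi>_and_trace[OF _ _ xyz])
    show "q u v \<xi> = 0" if "u \<in> S" "v \<in> S" for u v
      using that by (simp add: q_def r_\<xi> g_\<xi>)
    show "trace_on S (\<lambda>w. q w u v) = 0" if u: "u \<in> S" and v: "v \<in> S" for u v
    proof -
      \<comment> \<open>The three contributions are \<open>- 2 * g u v\<close> from the Ricci
        tensor, \<open>3 * g u v\<close> from the identity and \<open>- g v u\<close> from the
        rank-one map.\<close>
      have "trace_on S (\<lambda>w. q w u v) = trace_on S (\<lambda>w. r w u v + (g u v *\<^sub>R w + g v w *\<^sub>R (- u)))"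
        by (rule trace_on_cong) (simp add: q_def g_sym[of _ v] v)
      also have "\<dots> = ric u v + trace_on S (\<lambda>w. g u v *\<^sub>R w + g v w *\<^sub>R (- u))"
        unfolding ric_def by (rule trace_on_add) (use u v r_in diff scale in auto)
      also have "trace_on S (\<lambda>w. g u v *\<^sub>R w + g v w *\<^sub>R (- u)) =
          trace_on S (\<lambda>w. g u v *\<^sub>R w) + trace_on S (\<lambda>w. g v w *\<^sub>R (- u))"
        by (rule trace_on_add) (use u v scale minus in auto)
      also have "trace_on S (\<lambda>w. g u v *\<^sub>R w) = g u v * 3"
        by (subst trace_on_scale) (simp_all add: trace_on_id)
      also have "trace_on S (\<lambda>w. g v w *\<^sub>R (- u)) = g v (- u)"
        by (rule trace_on_rank_one[OF g_linear[OF v] minus[OF u]])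
      finally show ?thesis using ric[OF u v] g_sym[OF u v] u v by simp
    qed
  qed
  then show ?thesis by (simp add: q_def algebra_simps eq_neg_iff_add_eq_0)
qed

end

section \<open>Quasi-para-Sasakian manifolds\<close>

locale quasi_para_sasakian = levi_civita_manifold A g D
  for A :: "('m::{t2_space, second_countable_topology}, 'e::euclidean_space) chart set"
    and g :: "'m \<Rightarrow> 'm tangent_vector \<Rightarrow> 'm tangent_vector \<Rightarrow> real"
    and D :: "'m vector_field \<Rightarrow> 'm vector_field \<Rightarrow> 'm vector_field" +
  fixes \<phi> :: "'m \<Rightarrow> 'm tangent_vector \<Rightarrow> 'm tangent_vector"
    and \<eta> :: "'m \<Rightarrow> 'm tangent_vector \<Rightarrow> real" and \<xi> :: "'m vector_field"
  assumes quasi_para_sasakian: "quasi_para_sasakian_manifold A \<phi> \<eta> \<xi> g D"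
begin

lemma almost_paracontact: "almost_paracontact_metric_manifold A \<phi> \<eta> \<xi> g"
  using quasi_para_sasakian by (simp add: quasi_para_sasakian_manifold_def)

lemma \<xi>_VF: "\<xi> \<in> VF"
  and \<phi>_linear_on: "linear_on (T p) (\<phi> p)"
  and \<phi>_tangent: "u \<in> T p \<Longrightarrow> \<phi> p u \<in> T p"
  and \<eta>_linear_on: "linear_on (T p) (\<eta> p)"
  and \<phi>_of_\<xi>: "\<phi> p (\<xi> p) = 0"
  and \<eta>_of_\<xi>: "\<eta> p (\<xi> p) = 1"
  and \<eta>_of_\<phi>: "u \<in> T p \<Longrightarrow> \<eta> p (\<phi> p u) = 0"
  and \<phi>_of_\<phi>: "u \<in> T p \<Longrightarrow> \<phi> p (\<phi> p u) = u - \<eta> p u *\<^sub>R \<xi> p"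
  and paracomplex_at: "almost_paracomplex_structure {u\<in>T p. \<eta> p u = 0} (\<phi> p)"
  and g_of_\<phi>_\<phi>: "u \<in> T p \<Longrightarrow> v \<in> T p \<Longrightarrow> g p (\<phi> p u) (\<phi> p v) = - g p u v + \<eta> p u * \<eta> p v"
  using almost_paracontact
  by (simp_all add: almost_paracontact_metric_manifold_def tensor_field_1_1_def one_form_def)

lemma g_of_\<xi>: "u \<in> T p \<Longrightarrow> g p u (\<xi> p) = \<eta> p u"
proof -
  assume u: "u \<in> T p"
  have "g p (\<phi> p u) 0 = 0"
    using metric_diff_right[of "\<phi> p u" p 0 0] \<phi>_tangent[OF u] subspace_0[OF subspace_tangent] by simp
  then show ?thesis
    using g_of_\<phi>_\<phi>[OF u vector_field_tangent[OF \<xi>_VF]] by (simp add: \<phi>_of_\<xi> \<eta>_of_\<xi>)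
qed

lemma D_\<phi>:
  "X \<in> VF \<Longrightarrow> Y \<in> VF \<Longrightarrow>
    D X (\<lambda>q. \<phi> q (Y q)) p = \<phi> p (D X Y p) + g p (X p) (Y p) *\<^sub>R \<xi> p - \<eta> p (Y p) *\<^sub>R X p"
  using quasi_para_sasakian by (simp add: quasi_para_sasakian_manifold_def algebra_simps)

text \<open>\<open>\<eta>(\<nabla>\<^sub>X\<xi>) = 0\<close> because \<open>\<xi>\<close> has constant length; applying \<open>\<phi>\<close> to the structure equation
  for \<open>Y = \<xi>\<close> then isolates \<open>\<nabla>\<^sub>X\<xi>\<close>.\<close>

lemma D_\<xi>:
  assumes X: "X \<in> VF"
  shows "D X \<xi> = (\<lambda>q. \<phi> q (X q))"
proof
  fix p
  let ?V = "D X \<xi> p"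
  have V: "?V \<in> T p" and Xp: "X p \<in> T p" and \<xi>p: "\<xi> p \<in> T p"
    using vector_field_tangent D_VF X \<xi>_VF by auto
  have "X p (\<lambda>q. g q (\<xi> q) (\<xi> q)) = 0"
    using tangent_const[OF Xp] by (simp add: g_of_\<xi>[OF vector_field_tangent[OF \<xi>_VF]] \<eta>_of_\<xi>)
  then have "\<eta> p ?V = 0"
    using compatible[OF X \<xi>_VF \<xi>_VF, of p] metric_sym[OF \<xi>p V] g_of_\<xi>[OF V] by simp
  have "D X (\<lambda>q. \<phi> q (\<xi> q)) = 0"
    using D_zero_right[OF X] by (simp add: \<phi>_of_\<xi> zero_fun_def)
  then have "\<phi> p ?V = X p + (- \<eta> p (X p)) *\<^sub>R \<xi> p"
    using D_\<phi>[OF X \<xi>_VF, of p] by (simp add: g_of_\<xi>[OF Xp] \<eta>_of_\<xi> algebra_simps)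
  then have "\<phi> p (\<phi> p ?V) = \<phi> p (X p)"
    using linear_on_add[OF \<phi>_linear_on Xp subspace_scale[OF subspace_tangent \<xi>p], of "- \<eta> p (X p)"]
      linear_on_scaleR[OF \<phi>_linear_on \<xi>p, of "- \<eta> p (X p)"]
    by (simp add: \<phi>_of_\<xi>)
  then show "?V = \<phi> p (X p)"
    using \<phi>_of_\<phi>[OF V] \<open>\<eta> p ?V = 0\<close> by simp
qed

text \<open>By \<open>D_\<xi>\<close> the left side is the derivative of \<open>\<phi> Y\<close>
  along \<open>X\<close>, minus that of \<open>\<phi> X\<close> along \<open>Y\<close>, minus
  \<open>\<phi>\<close> of the bracket. Torsion-freeness reduces this to the difference of two
  structure equations, in which the multiples of \<open>\<xi>\<close> cancel by symmetry of
  \<open>g\<close>.\<close>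

lemma R_\<xi>:
  assumes X: "X \<in> VF" and Y: "Y \<in> VF"
  shows "R X Y \<xi> p = \<eta> p (X p) *\<^sub>R Y p - \<eta> p (Y p) *\<^sub>R X p"
proof -
  note T = vector_field_tangent
  have "\<phi> p (lie_bracket X Y p) = \<phi> p (D X Y p) - \<phi> p (D Y X p)"
  proof -
    have "lie_bracket X Y p = D X Y p + (-1) *\<^sub>R D Y X p"
      by (simp add: torsion_free X Y)
    then show ?thesis
      using linear_on_add[OF \<phi>_linear_on T[OF D_VF[OF X Y]] subspace_scale[OF subspace_tangent T[OF D_VF[OF Y X]]],
          of p "-1"] linear_on_scaleR[OF \<phi>_linear_on T[OF D_VF[OF Y X]], of p "-1"]
      by simp
  qed
  then show ?thesis
    by (simp add: curvature_operator_def D_\<xi> X Y lie_bracket_VF D_\<phi>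
        metric_sym[OF T[OF Y] T[OF X]])
qed

text \<open>The claim is pointwise: each tangent space with its curvature tensor is an instance of
  \<open>paracontact_curvature\<close>, and \<open>ricci\<close> is the trace used there.\<close>

lemma constant_curvature_if_ricci_semisymmetric:
  assumes dim: "DIM('e) = 3" and semi: "ricci_semisymmetric A D"
  shows "constant_curvature A g D (-1)"
  unfolding constant_curvature_def
proof (intro allI ballI)
  fix p x y z assume xyz: "x \<in> T p" "y \<in> T p" "z \<in> T p"
  have \<xi>p: "\<xi> p \<in> T p" by (rule vector_field_tangent[OF \<xi>_VF])
  interpret P: paracontact_curvature "T p" "g p" "\<phi> p" "\<eta> p" "\<xi> p" "curvature_tensor A D p"
  proof
    show "\<exists>B. finite B \<and> independent B \<and> span B = T p \<and> card B = 3"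
      using tangent_basis[of p] dim by metis
  qed (fact metric_linear metric_sym metric_nondegenerate \<phi>_linear_on \<phi>_tangent \<eta>_linear_on \<xi>p \<phi>_of_\<xi>
      \<eta>_of_\<xi> \<eta>_of_\<phi> \<phi>_of_\<phi> paracomplex_at g_of_\<phi>_\<phi> curvature_tensor_tangent
      curvature_tensor_linear_left curvature_tensor_linear_right curvature_tensor_skew
      curvature_tensor_bianchi curvature_tensor_metric_skew)+
  have "curvature_tensor A D p u v (\<xi> p) = \<eta> p u *\<^sub>R v - \<eta> p v *\<^sub>R u" if "u \<in> T p" "v \<in> T p" for u v
    using curvature_tensor_eq[OF ext_VF[OF that(1)] ext_VF[OF that(2)] \<xi>_VF, of p]
      R_\<xi>[OF ext_VF[OF that(1)] ext_VF[OF that(2)], of p] by (simp add: ext_at that)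
  from P.constant_curvature_if_ricci_semisymmetric[OF this _ xyz] semi
  show "curvature_tensor A D p x y z = (-1) *\<^sub>R (g p y z *\<^sub>R x - g p x z *\<^sub>R y)"
    by (simp add: ricci_semisymmetric_def ricci_def)
qed

end

theorem theorem6p2:
  fixes A :: "('m::{t2_space, second_countable_topology}, real ^ 3) chart set"
    and \<phi> :: "'m \<Rightarrow> 'm tangent_vector \<Rightarrow> 'm tangent_vector"
    and \<eta> :: "'m \<Rightarrow> 'm tangent_vector \<Rightarrow> real"
    and \<xi> :: "'m vector_field"
    and g :: "'m \<Rightarrow> 'm tangent_vector \<Rightarrow> 'm tangent_vector \<Rightarrow> real"
    and D :: "'m vector_field \<Rightarrow> 'm vector_field \<Rightarrow> 'm vector_field"
  assumes "quasi_para_sasakian_manifold A \<phi> \<eta> \<xi> g D"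
    and "ricci_semisymmetric A D"
  shows "constant_curvature A g D (-1)"
proof -
  interpret quasi_para_sasakian A g D \<phi> \<eta> \<xi>
    using assms(1)
    by unfold_locales
      (simp_all add: quasi_para_sasakian_manifold_def almost_paracontact_metric_manifold_def)
  show ?thesis
    by (rule constant_curvature_if_ricci_semisymmetric[OF _ assms(2)]) simp
qed

end
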